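(* Let $d\ge 2$, $0<\beta\le 1$, $0<\alpha<2$, and let $\mu_\beta$ be the (standard, non-product) Mittag-Leffler measure on $\mathcal S_d'(\mathbb R)$. On the probability space $(\mathcal S_d'(\mathbb R),\mu_\beta)$ consider the $\mathbb R^d$-valued process $$B_t=\big(\langle\cdot,(M^{\alpha/2}_-\mathbf 1_{[0,t)})\mathbf e_1\rangle,\dots,\langle\cdot,(M^{\alpha/2}_-\mathbf 1_{[0,t)})\mathbf e_d\rangle\big),\qquad t\ge 0.$$ Then $(B_t)_{t\ge0}$ has independent components if and only if it is a ($d$-dimensional) fractional Brownian motion, i.e. if and only if $\beta=1$.
   Context: $E_\beta(z)=\sum_{n=0}^\infty \frac{z^n}{\Gamma(\beta n+1)}$. $\mathcal S(\mathbb R)$ is the real Schwartz space, $\mathcal S_d(\mathbb R)=\bigoplus_{k=1}^d\mathcal S(\mathbb R)$, $L^2_d(\mathbb R)=L^2(\mathbb R;\mathbb R^d)$ with norm $|\cdot|_0$, $\mathcal S_d'(\mathbb R)$ is the dual of $\mathcal S_d(\mathbb R)$ with the cylinder $\sigma$-algebra, and $\{\mathbf e_1,\dots,\mathbf e_d\}$ is the canonical basis of $\mathbb R^d$. The standard Mittag-Leffler measure $\mu_\beta$ on $\mathcal S_d'(\mathbb R)$ is the unique probability measure with $\int e^{i\langle\omega,\varphi\rangle}\,d\mu_\beta(\omega)=E_\beta(-\tfrac12|\varphi|_0^2)$ for all $\varphi\in\mathcal S_d(\mathbb R)$. For $\eta\in L^2_d(\mathbb R)$, $\langle\cdot,\eta\rangle$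 is the $L^2(\mu_\beta)$-limit of $\langle\cdot,\varphi_n\rangle$ for any $\varphi_n\in\mathcal S_d(\mathbb R)$ with $\varphi_n\to\eta$ in $L^2_d(\mathbb R)$. The operator $M^{\alpha/2}_-$: with $K_{\alpha/2}=\sqrt{\alpha\sin(\alpha\pi/2)\Gamma(\alpha)}$, $M^{\alpha/2}_-f=K_{\alpha/2}D_-^{(1-\alpha)/2}f$ for $0<\alpha<1$, $M_-^{1/2}f=f$ for $\alpha=1$, and $M^{\alpha/2}_-f=K_{\alpha/2}I_-^{(\alpha-1)/2}f$ for $1<\alpha<2$, where $(I_-^rf)(x)=\frac1{\Gamma(r)}\int_x^\infty f(t)(t-x)^{r-1}dt$ (Riemann-Liouville fractional integral) and $(D_-^rf)(x)=\lim_{\varepsilon\to0+}\frac{r}{\Gamma(1-r)}\int_\varepsilon^\infty\frac{f(x)-f(x+t)}{t^{1+r}}dt$ (Marchaud fractional derivative). It is known that $M^{\alpha/2}_-\mathbf 1_{[0,t)}\in L^2(\mathbb R)$ and $(M^{\alpha/2}_-\mathbf 1_{[0,t)},M^{\alpha/2}_-\mathbf 1_{[0,s)})_{L^2(\mathbb R)}=\frac12(t^\alpha+s^\alpha-|t-s|^\alpha)$ for $s,t\ge0$. "Independent components" means that the $d$ real-valued component processes are mutually independent. A $d$-dimensional fractional Brownian motion (with Hurst parameter $\alpha/2$) is a centered Gaussian process with independent components, each having covariance $\frac12(t^\alpha+s^\alpha-|t-s|^\alpha)$. *)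

theory Defs
  imports "HOL-Probability.Probability"
begin

section \<open>Schwartz functions and tempered distributions\<close>

definition schwartz :: "(real \<Rightarrow> real) set" where
  "schwartz = {f. (\<forall>n x. ((deriv ^^ n) f) field_differentiable (at x)) \<and>
                  (\<forall>k n. bounded (range (\<lambda>x. x ^ k * (deriv ^^ n) f x)))}"

definition schwartz_seminorm :: "nat \<Rightarrow> nat \<Rightarrow> (real \<Rightarrow> real) \<Rightarrow> real" where
  "schwartz_seminorm k n f = (SUP x. \<bar>x ^ k * (deriv ^^ n) f x\<bar>)"

text \<open>The direct sum of \<open>d\<close> copies of the Schwartz space, with \<open>d = CARD('d)\<close>, and its
  locally convex topology.\<close>

definition schwartz_vec :: "(real \<Rightarrow> real ^ 'd) set" where
  "schwartz_vec = {\<phi>. \<forall>i. (\<lambda>x. \<phi> x $ i) \<in> schwartz}"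

definition schwartz_topology :: "(real \<Rightarrow> real ^ 'd) topology" where
  "schwartz_topology = topology_generated_by
     {{\<psi> \<in> schwartz_vec. schwartz_seminorm k n (\<lambda>x. \<psi> x $ i - \<phi> x $ i) < e} | \<phi> k n i e.
        \<phi> \<in> schwartz_vec \<and> e > 0}"

text \<open>A functional on the Schwartz space is represented by a function on all of
  \<open>real \<Rightarrow> real ^ 'd\<close>; membership in \<^const>\<open>extensional\<close> fixes its irrelevant values, so that
  functionals are equal iff they agree on \<open>schwartz_vec\<close>.\<close>

type_synonym 'd functional = "(real \<Rightarrow> real ^ 'd) \<Rightarrow> real"

definition tempered :: "('d::finite) functional set" where
  "tempered = {\<omega> \<in> extensional schwartz_vec.
     (\<forall>\<phi>\<in>schwartz_vec. \<forall>\<psi>\<in>schwartz_vec. \<omega> (\<lambda>x. \<phi> x + \<psi> x) = \<omega> \<phi> + \<omega> \<psi>) \<and>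
     (\<forall>c. \<forall>\<phi>\<in>schwartz_vec. \<omega> (\<lambda>x. c *\<^sub>R \<phi> x) = c * \<omega> \<phi>) \<and>
     continuous_map schwartz_topology euclideanreal \<omega>}"

definition cylinder_algebra :: "('d::finite) functional measure" where
  "cylinder_algebra = sigma tempered
     {{\<omega> \<in> tempered. restrict \<omega> J \<in> A} | J A.
        finite J \<and> J \<subseteq> schwartz_vec \<and> A \<in> sets (Pi\<^sub>M J (\<lambda>_. borel))}"

section \<open>Square-integrable functions\<close>

definition L2_space :: "'a measure \<Rightarrow> ('a \<Rightarrow> 'b::real_normed_vector) set" where
  "L2_space M = {f \<in> borel_measurable M. integrable M (\<lambda>x. (norm (f x))\<^sup>2)}"

definition L2_norm :: "'a measure \<Rightarrow> ('a \<Rightarrow> 'b::real_normed_vector) \<Rightarrow> real" where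
  "L2_norm M f = sqrt (\<integral>x. (norm (f x))\<^sup>2 \<partial>M)"

definition L2_tendsto ::
    "'a measure \<Rightarrow> (nat \<Rightarrow> 'a \<Rightarrow> 'b::real_normed_vector) \<Rightarrow> ('a \<Rightarrow> 'b) \<Rightarrow> bool" where
  "L2_tendsto M f g \<longleftrightarrow> (\<forall>n. f n \<in> L2_space M) \<and> g \<in> L2_space M \<and>
     (\<lambda>n. L2_norm M (\<lambda>x. f n x - g x)) \<longlonglongrightarrow> 0"

section \<open>Mittag-Leffler measure\<close>

definition mittag_leffler :: "real \<Rightarrow> complex \<Rightarrow> complex" where
  "mittag_leffler \<beta> z = (\<Sum>n. z ^ n / of_real (Gamma (\<beta> * real n + 1)))"

text \<open>By the Bochner-Minlos theorem exactly one measure satisfies this predicate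
  when \<open>0 < \<beta> \<le> 1\<close>.\<close>

definition mittag_leffler_measure :: "real \<Rightarrow> ('d::finite) functional measure \<Rightarrow> bool" where
  "mittag_leffler_measure \<beta> \<mu> \<longleftrightarrow> prob_space \<mu> \<and> sets \<mu> = sets cylinder_algebra \<and>
     (\<forall>\<phi>\<in>schwartz_vec. (\<integral>\<omega>. exp (\<i> * complex_of_real (\<omega> \<phi>)) \<partial>\<mu>)
        = mittag_leffler \<beta> (of_real (- (1/2) * (L2_norm lborel \<phi>)\<^sup>2)))"

text \<open>The pairing with \<open>\<eta>\<close> in \<open>L\<^sup>2\<close> is an element of \<open>L\<^sup>2(\<mu>)\<close>, hence determined only up to
  \<open>\<mu>\<close>-null sets; \<open>dual_pairing \<mu> \<eta> X\<close> says that \<open>X\<close> is a version of it. Since the limit does not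
  depend on the approximating sequence, one sequence suffices.\<close>

definition dual_pairing ::
    "('d::finite) functional measure \<Rightarrow> (real \<Rightarrow> real ^ 'd) \<Rightarrow> ('d functional \<Rightarrow> real) \<Rightarrow> bool" where
  "dual_pairing \<mu> \<eta> X \<longleftrightarrow> (\<exists>\<phi>. (\<forall>n. \<phi> n \<in> schwartz_vec) \<and>
     L2_tendsto lborel \<phi> \<eta> \<and> L2_tendsto \<mu> (\<lambda>n \<omega>. \<omega> (\<phi> n)) X)"

section \<open>Fractional operators\<close>

definition rl_integral :: "real \<Rightarrow> (real \<Rightarrow> real) \<Rightarrow> real \<Rightarrow> real" where
  "rl_integral r f x = 1 / Gamma r * (LINT t:{x<..}|lborel. f t * (t - x) powr (r - 1))"

definition marchaud :: "real \<Rightarrow> (real \<Rightarrow> real) \<Rightarrow> real \<Rightarrow> real" where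
  "marchaud r f x = Lim (at_right 0)
     (\<lambda>\<epsilon>. r / Gamma (1 - r) * (LINT t:{\<epsilon><..}|lborel. (f x - f (x + t)) / t powr (1 + r)))"

definition M_const :: "real \<Rightarrow> real" where
  "M_const \<alpha> = sqrt (\<alpha> * sin (\<alpha> * pi / 2) * Gamma \<alpha>)"

definition M_minus :: "real \<Rightarrow> (real \<Rightarrow> real) \<Rightarrow> real \<Rightarrow> real" where
  "M_minus \<alpha> f x =
     (if \<alpha> < 1 then M_const \<alpha> * marchaud ((1 - \<alpha>) / 2) f x
      else if \<alpha> = 1 then f x
      else M_const \<alpha> * rl_integral ((\<alpha> - 1) / 2) f x)"

section \<open>Processes indexed by \<open>[0, \<infinity>)\<close>\<close>

text \<open>Mutual independence of the components as random elements of the path space with its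
  product \<open>\<sigma>\<close>-algebra.\<close>

definition indep_components :: "'w measure \<Rightarrow> (real \<Rightarrow> 'w \<Rightarrow> real ^ 'd) \<Rightarrow> bool" where
  "indep_components M B \<longleftrightarrow> prob_space.indep_vars M (\<lambda>_. Pi\<^sub>M {0..} (\<lambda>_. borel))
     (\<lambda>i \<omega>. \<lambda>t\<in>{0..}. B t \<omega> $ i) UNIV"

text \<open>Degenerate Gaussian variables are included (for instance at time \<open>0\<close>).\<close>

definition gaussian :: "'w measure \<Rightarrow> ('w \<Rightarrow> real) \<Rightarrow> bool" where
  "gaussian M X \<longleftrightarrow> X \<in> borel_measurable M \<and>
     ((\<exists>m. AE \<omega> in M. X \<omega> = m) \<or>
      (\<exists>m \<sigma>. \<sigma> > 0 \<and> distributed M lborel X (\<lambda>x. ennreal (normal_density m \<sigma> x))))"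

definition gaussian_process :: "'w measure \<Rightarrow> (real \<Rightarrow> 'w \<Rightarrow> real ^ 'd) \<Rightarrow> bool" where
  "gaussian_process M B \<longleftrightarrow> (\<forall>J c. finite J \<and> J \<subseteq> {0..} \<longrightarrow>
     gaussian M (\<lambda>\<omega>. \<Sum>t\<in>J. c t \<bullet> B t \<omega>))"

text \<open>Fractional Brownian motion with Hurst parameter \<open>\<alpha> / 2\<close>. The process is centered, so the
  covariance is the expectation of the product.\<close>

definition fractional_brownian_motion ::
    "'w measure \<Rightarrow> real \<Rightarrow> (real \<Rightarrow> 'w \<Rightarrow> real ^ 'd) \<Rightarrow> bool" where
  "fractional_brownian_motion M \<alpha> B \<longleftrightarrow>
     gaussian_process M B \<and>
     (\<forall>i. \<forall>t\<ge>0. (\<integral>\<omega>. B t \<omega> $ i \<partial>M) = 0) \<and>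
     indep_components M B \<and>
     (\<forall>i. \<forall>t\<ge>0. \<forall>s\<ge>0. (\<integral>\<omega>. B t \<omega> $ i * B s \<omega> $ i \<partial>M)
        = (t powr \<alpha> + s powr \<alpha> - \<bar>t - s\<bar> powr \<alpha>) / 2)"

end

(* Every pairing is an L2 limit of evaluations at Schwartz functions, so by continuity of E_beta the
   variable paired with eta has characteristic function E_beta(- theta^2 |eta|^2 / 2), and linear
   combinations of the B_t^i are again pairings.

   If the components are independent, two of them at time 1 give E_beta(-2x) = E_beta(-x)^2 for x > 0.
   Comparing second-order coefficients yields Gamma(2 beta + 1) = 2 Gamma(beta + 1)^2, which holds at
   beta = 1 and, since Digamma is strictly increasing, at no beta in (0,1).

   If beta = 1 the characteristic functions are Gaussian and factorise over the components. The
   covariance reduces by polarisation, translation and scaling to the norm of M 1_[0,1), which is the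
   Mandelbrot - van Ness integral. *)

theory Submission
  imports Defs "HOL-Real_Asymp.Real_Asymp"
begin

text \<open>Correlation cannot tell \<beta> = 1 from \<beta> < 1: the law of the variable paired
  with \<eta> depends on \<eta> only through its norm, distinct components are uncorrelated for
  every \<beta>, and the first-order coefficients of E_\<beta>(-2x) and E_\<beta>(-x)^2 agree as
  well. The second-order coefficient, which carries the fourth moments, is the earliest place where
  a difference shows.

  The converse must deliver independence of whole paths, indexed by an uncountable set of times.
  Cylinder sets reduce this to finitely many times. Uniqueness for characteristic functions in
  several variables is drawn from the one-dimensional case: exponentials are exchanged for
  indicators one coordinate at a time, and those already exchanged act as a weight on the measure.

  The kernel integral resists termwise treatment, because no single term of the expanded ((1 + x)^p
  - x^p)^2 is integrable at infinity. An antiderivative is therefore given explicitly, up to an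
  incomplete Beta integral. \<open>M_const\<close> is the constant that cancels the resulting Gamma
  and sine factors.\<close>

section \<open>The operator \<open>M_minus\<close> on indicator functions\<close>

text \<open>As \<open>0 powr 0 = 0\<close>, \<open>pospow 0\<close> is the indicator of the positive half-line; this lets one
  formula for \<open>M_minus\<close> cover \<open>\<alpha> = 1\<close>.\<close>

definition pospow :: "real \<Rightarrow> real \<Rightarrow> real" where
  "pospow p y = (max 0 y) powr p"

section \<open>Integrals of powers over a half-line and over a bounded interval\<close>

lemma has_bochner_integral_powr_tail:
  fixes c r :: real assumes "0 < c" "0 < r"
  shows "has_bochner_integral lborel (\<lambda>u. indicator {c<..} u *\<^sub>R u powr (-1 - r)) (c powr (- r) / r)"
proof -
  have ab: "ereal c < \<infinity>" by simp
  have D: "((\<lambda>u. - (u powr (-r) / r)) has_real_derivative x powr (-1 - r)) (at x)" if "c < x" for x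
    using that assms by (auto intro!: derivative_eq_intros simp: field_simps minus_diff_commute)
  have C: "isCont (\<lambda>u. u powr (-1 - r)) x" if "c < x" for x
    using that assms by (auto intro!: continuous_intros)
  have A: "(((\<lambda>u. - (u powr (-r) / r)) \<circ> real_of_ereal) \<longlongrightarrow> - (c powr (-r) / r)) (at_right (ereal c))"
    using assms unfolding ereal_tendsto_simps by (auto intro!: tendsto_eq_intros)
  have B: "(((\<lambda>u. - (u powr (-r) / r)) \<circ> real_of_ereal) \<longlongrightarrow> 0) (at_left \<infinity>)"
    using assms unfolding ereal_tendsto_simps by real_asymp
  note F = interval_integral_FTC_nonneg[OF ab, of "\<lambda>u. - (u powr (-r) / r)" "\<lambda>u. u powr (-1 - r)", OF _ _ _ A B]
  have "set_integrable lborel (einterval (ereal c) \<infinity>) (\<lambda>u. u powr (-1 - r))"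
    by (rule F(1)) (auto intro: D C)
  moreover have "(LBINT x=ereal c..\<infinity>. x powr (-1 - r)) = 0 - - (c powr (-r) / r)"
    by (rule F(2)) (auto intro: D C)
  ultimately show ?thesis
    by (simp add: has_bochner_integral_iff set_integrable_def interval_lebesgue_integral_def
          set_lebesgue_integral_def einterval_def greaterThan_def)
qed

text \<open>The integrand may blow up at \<open>x\<close>, but its antiderivative
  \<open>(u - x) powr r / r\<close> still tends to 0 there because r > 0. The fundamental theorem
  for nonnegative integrands then yields integrability together with the value.\<close>

lemma has_bochner_integral_powr_head:
  fixes c r x :: real assumes "x < c" "0 < r"
  shows "has_bochner_integral lborel (\<lambda>u. indicator {x<..<c} u *\<^sub>R (u - x) powr (r - 1)) ((c - x) powr r / r)"
proof -
  have ab: "ereal x < ereal c" using assms by simp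
  have D: "((\<lambda>u. (u - x) powr r / r) has_real_derivative (y - x) powr (r - 1)) (at y)" if "x < y" for y
    using that assms by (auto intro!: derivative_eq_intros simp: field_simps)
  have C: "isCont (\<lambda>u. (u - x) powr (r - 1)) y" if "x < y" for y
    using that assms by (auto intro!: continuous_intros)
  have A: "(((\<lambda>u. (u - x) powr r / r) \<circ> real_of_ereal) \<longlongrightarrow> 0) (at_right (ereal x))"
    using assms unfolding ereal_tendsto_simps 
    by (auto intro!: tendsto_eq_intros simp: eventually_at_right_field intro!: exI[of _ "x+1"])
  have B: "(((\<lambda>u. (u - x) powr r / r) \<circ> real_of_ereal) \<longlongrightarrow> (c - x) powr r / r) (at_left (ereal c))"
    using assms unfolding ereal_tendsto_simps by (auto intro!: tendsto_eq_intros)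
  note F = interval_integral_FTC_nonneg[OF ab, of "\<lambda>u. (u - x) powr r / r" "\<lambda>u. (u - x) powr (r - 1)", OF _ _ _ A B]
  have "set_integrable lborel (einterval (ereal x) (ereal c)) (\<lambda>u. (u - x) powr (r - 1))"
    by (rule F(1)) (auto intro: D C)
  moreover have "(LBINT y=ereal x..ereal c. (y - x) powr (r - 1)) = (c - x) powr r / r - 0"
    by (rule F(2)) (auto intro: D C)
  ultimately show ?thesis using assms
    by (simp add: has_bochner_integral_iff set_integrable_def interval_lebesgue_integral_def
          set_lebesgue_integral_def einterval_def greaterThanLessThan_def greaterThan_def lessThan_def Int_def)
qed

text \<open>The indicator of [0,T) is the difference of the half-lines x < T and x < 0, and each of
  them contributes one tail integral. Such a tail no longer depends on \<epsilon> once \<epsilon>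
  lies below its starting point, so the limit is that of an eventually constant function.\<close>

lemma marchaud_indicator:
  assumes r: "0 < r" "r < 1" and T: "0 \<le> T"
  shows "marchaud r (indicator {0..<T}) x = (pospow (-r) (T - x) - pospow (-r) (- x)) / Gamma (1 - r)"
proof -
  \<comment> \<open>With H the indicator of the positive half-line, the bracket is H(c) - H(c - u)
    for u > 0: a jump at distance c is felt exactly by the steps u of length at least c.\<close>
  define s where "s c u = (if 0 < c \<and> c \<le> u then 1 else 0 :: real) * u powr (-1 - r)" for c u :: real
  have s: "has_bochner_integral lborel (\<lambda>u. indicator {\<epsilon><..} u *\<^sub>R s c u)
      (if 0 < c then max \<epsilon> c powr (- r) / r else 0)" if "0 < \<epsilon>" for \<epsilon> c
  proof (cases "0 < c")
    case True
    have "has_bochner_integral lborel (\<lambda>u. indicator {max \<epsilon> c<..} u *\<^sub>R u powr (-1 - r)) (max \<epsilon> c powr (- r) / r)"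
      by (rule has_bochner_integral_powr_tail) (use that r in auto)
    \<comment> \<open>\<open>s\<close> includes the endpoint u = c, whereas the open tail leaves it
      out.\<close>
    moreover have "AE u in lborel. indicator {max \<epsilon> c<..} u *\<^sub>R u powr (-1 - r) = indicator {\<epsilon><..} u *\<^sub>R s c u"
      using AE_lborel_singleton[of c]
      by eventually_elim (use True in \<open>auto simp: s_def indicator_def\<close>)
    ultimately show ?thesis
      using True by (subst has_bochner_integral_cong_AE[where g="\<lambda>u. indicator {max \<epsilon> c<..} u *\<^sub>R u powr (-1 - r)"])
         (auto simp: s_def)
  next
    case False
    then have "s c = (\<lambda>_. 0)" by (auto simp: s_def)
    then show ?thesis using False has_bochner_integral_zero by simp
  qed
  have eq: "(indicator {0..<T} x - indicator {0..<T} (x + u)) / u powr (1 + r) = s (T - x) u - s (- x) u"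
    if "0 < u" for u
    using that T by (auto simp: s_def indicator_def powr_minus field_simps powr_diff powr_add)
  have trunc: "(LINT u:{\<epsilon><..}|lborel. (indicator {0..<T} x - indicator {0..<T} (x + u)) / u powr (1 + r))
      = (pospow (-r) (T - x) - pospow (-r) (- x)) / r" 
    if e: "0 < \<epsilon>" "0 < T - x \<Longrightarrow> \<epsilon> < T - x" "0 < - x \<Longrightarrow> \<epsilon> < - x" for \<epsilon>
  proof -
    have "(LINT u:{\<epsilon><..}|lborel. (indicator {0..<T} x - indicator {0..<T} (x + u)) / u powr (1 + r))
      = (LINT u|lborel. indicator {\<epsilon><..} u *\<^sub>R s (T - x) u - indicator {\<epsilon><..} u *\<^sub>R s (- x) u)"
      unfolding set_lebesgue_integral_def
      by (rule Bochner_Integration.integral_cong) (use e(1) eq in \<open>auto simp: indicator_def[of "{\<epsilon><..}"]\<close>)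
    also have "\<dots> = (if 0 < T - x then max \<epsilon> (T - x) powr (- r) / r else 0) - (if 0 < -x then max \<epsilon> (-x) powr (- r) / r else 0)"
      by (intro has_bochner_integral_integral_eq has_bochner_integral_diff s e)
    also have "\<dots> = (pospow (-r) (T - x) - pospow (-r) (- x)) / r"
      using e by (auto simp: pospow_def max_def diff_divide_distrib)
    finally show ?thesis .
  qed
  \<comment> \<open>Below \<open>m\<close>, \<epsilon> is smaller than whichever of T - x and -x is
    positive; the value 1 is a filler for the others.\<close>
  define m where "m = min (if 0 < T - x then T - x else 1) (if 0 < - x then - x else 1)"
  have m: "0 < m" by (simp add: m_def)
  have "\<forall>\<^sub>F \<epsilon> in at_right 0. r / Gamma (1 - r) *
      (LINT u:{\<epsilon><..}|lborel. (indicator {0..<T} x - indicator {0..<T} (x + u)) / u powr (1 + r))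
      = (pospow (-r) (T - x) - pospow (-r) (- x)) / Gamma (1 - r)"
    using eventually_at_right_less eventually_at_right_real[OF m]
  proof eventually_elim
    case (elim \<epsilon>)
    then have "0 < \<epsilon>" "0 < T - x \<Longrightarrow> \<epsilon> < T - x" "0 < - x \<Longrightarrow> \<epsilon> < - x"
      by (auto simp: m_def)
    from trunc[OF this] show ?case using r by simp
  qed
  then show ?thesis
    unfolding marchaud_def by (intro tendsto_Lim tendsto_eventually) auto
qed

lemma rl_integral_indicator:
  assumes r: "0 < r" and T: "0 \<le> T"
  shows "rl_integral r (indicator {0..<T}) x = (pospow r (T - x) - pospow r (- x)) / Gamma (r + 1)"
proof -
  have s: "has_bochner_integral lborel (\<lambda>u. indicator {x<..<c} u *\<^sub>R (u - x) powr (r - 1)) (pospow r (c - x) / r)" for c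
    using has_bochner_integral_powr_head[of x c r] r by (cases "x < c") (auto simp: pospow_def max_def)
  have "(LINT t:{x<..}|lborel. indicator {0..<T} t * (t - x) powr (r - 1)) =
    (LINT u|lborel. indicator {x<..<T} u *\<^sub>R (u - x) powr (r - 1) - indicator {x<..<0} u *\<^sub>R (u - x) powr (r - 1))"
    unfolding set_lebesgue_integral_def
    by (rule Bochner_Integration.integral_cong) (use T in \<open>auto simp: indicator_def\<close>)
  also have "\<dots> = pospow r (T - x) / r - pospow r (0 - x) / r"
    by (intro has_bochner_integral_integral_eq has_bochner_integral_diff s)
  finally show ?thesis
    using r by (simp add: rl_integral_def Gamma_plus1[of r] nonpos_Ints_def diff_divide_distrib)
qed

text \<open>With p = (\<alpha> - 1)/2 the Marchaud case has r = -p and the Riemann-Liouville case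
  has r = p, so 1 - r and r + 1 respectively both equal (\<alpha> + 1)/2. The result is the
  Mandelbrot-van Ness kernel. At \<alpha> = 1 the prefactor is 1.\<close>

lemma M_minus_indicator:
  assumes "0 < \<alpha>" "\<alpha> < 2" "0 \<le> T"
  shows "M_minus \<alpha> (indicator {0..<T}) x = M_const \<alpha> / Gamma ((\<alpha> + 1) / 2) *
     (pospow ((\<alpha> - 1) / 2) (T - x) - pospow ((\<alpha> - 1) / 2) (- x))"
proof -
  consider "\<alpha> < 1" | "\<alpha> = 1" | "\<alpha> > 1" by linarith
  then show ?thesis
  proof cases
    case 1
    have e: "- ((1 - \<alpha>) / 2) = (\<alpha> - 1) / 2" "1 - ((1 - \<alpha>) / 2) = (\<alpha> + 1) / 2"
      by (simp_all add: field_simps)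
    show ?thesis using marchaud_indicator[of "(1 - \<alpha>) / 2" T x] 1 assms
      unfolding e by (simp add: M_minus_def)
  next
    case 2
    then show ?thesis using assms
      by (auto simp: M_minus_def M_const_def pospow_def indicator_def)
  next
    case 3
    have e: "(\<alpha> - 1) / 2 + 1 = (\<alpha> + 1) / 2"
      by (simp_all add: field_simps)
    show ?thesis using rl_integral_indicator[of "(\<alpha> - 1) / 2" T x] 3 assms
      unfolding e by (simp add: M_minus_def)
  qed
qed

section \<open>The Mandelbrot--van Ness integral\<close>

text \<open>Each term is of order x^(2p+1) or x^(2p) and need not vanish by itself. Factoring out
  x^(2p+1) and expanding in h = 1/x, the coefficients of 1 and h cancel, which leaves order
  x^(2p-1), and 2p - 1 < 0.\<close>

lemma mandelbrot_van_ness_boundary_term: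
  fixes p :: real assumes "p < 1/2"
  shows "((\<lambda>x. (1 + x) powr (2*p+1) + x powr (2*p+1) - 2 * (x powr (p+1) * (1+x) powr p)
           - x powr (p+1) * (1+x) powr (p-1)) \<longlongrightarrow> 0) at_top"
proof -
  \<comment> \<open>The bracket after factoring out x^(2p+1), divided by h^2. What matters about its
    limit at 0 is that it is finite.\<close>
  define q where "q h = ((1 + h) powr (2*p+1) + 1 - 2 * (1+h) powr p - h*(1+h) powr (p-1))/h^2" for h :: real
  have "(q \<longlongrightarrow> p * (2 * p + 1) - (p - 1) * p - (p - 1)) (at_right 0)"
    unfolding q_def by real_asymp
  moreover have "filterlim (\<lambda>x::real. 1 / x) (at_right 0) at_top" by real_asymp
  ultimately have "((\<lambda>x. q (1 / x)) \<longlongrightarrow> p * (2 * p + 1) - (p - 1) * p - (p - 1)) at_top"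
    by (rule filterlim_compose)
  moreover have "((\<lambda>x. x powr (2*p-1)) \<longlongrightarrow> 0) (at_top)" using assms by real_asymp
  ultimately have "((\<lambda>x. x powr (2*p-1) * q (1 / x)) \<longlongrightarrow> 0) at_top"
    using tendsto_mult by fastforce
  moreover have "\<forall>\<^sub>F x in at_top. x powr (2*p-1) * q (1 / x) = 
      (1 + x) powr (2*p+1) + x powr (2*p+1) - 2 * (x powr (p+1) * (1+x) powr p)
           - x powr (p+1) * (1+x) powr (p-1)"
    using eventually_gt_at_top[of 0]
  proof eventually_elim
    fix x :: real assume x: "0 < x"
    have s: "(1 + 1 / x) powr a = (1 + x) powr a / x powr a" for a
      using x by (subst powr_divide[symmetric]) (auto simp: field_simps)
    have "x powr (2*p-1) * q (1 / x) = x powr (2*p-1) * x^2 * ((1 + x) powr (2*p+1) / x powr (2*p+1) + 1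
       - 2 * ((1+x) powr p / x powr p) - (1 / x)*((1+x) powr (p-1) / x powr (p - 1)))"
      using x unfolding q_def s by (simp add: field_simps)
    also have "x powr (2*p-1) * x^2 = x powr (2*p+1)"
      using x by (simp flip: powr_numeral powr_add add: add.commute)
    also have "x powr (2*p+1) * ((1 + x) powr (2*p+1) / x powr (2*p+1) + 1
       - 2 * ((1+x) powr p / x powr p) - (1 / x)*((1+x) powr (p-1) / x powr (p - 1)))
      = (1 + x) powr (2*p+1) + x powr (2*p+1) - 2 * (x powr (2*p+1) / x powr p * (1+x) powr p)
           - x powr (2*p+1) / (x * x powr (p-1)) * (1+x) powr (p-1)"
      using x by (simp add: algebra_simps)
    also have "x powr (2*p+1) / x powr p = x powr (p+1)"
      using x by (simp flip: powr_diff)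
    also have "x powr (2*p+1) / (x * x powr (p-1)) = x powr (p+1)"
      using x by (simp add: powr_mult_base flip: powr_diff)
    finally show "x powr (2*p-1) * q (1 / x) = 
      (1 + x) powr (2*p+1) + x powr (2*p+1) - 2 * (x powr (p+1) * (1+x) powr p)
           - x powr (p+1) * (1+x) powr (p-1)" .
  qed
  ultimately show ?thesis by (rule Lim_transform_eventually)
qed

text \<open>\<open>G\<close> is the integral of the Beta density from 0 to u. Its limits at the
  endpoints come from continuity of the indefinite integral, even where the integrand is
  unbounded.\<close>

lemma incomplete_Beta:
  fixes a b :: real assumes "0 < a" "0 < b"
  obtains G where "\<And>u. 0 < u \<Longrightarrow> u < 1 \<Longrightarrow> (G has_real_derivative u powr (a - 1) * (1 - u) powr (b - 1)) (at u)"
    "(G \<longlongrightarrow> 0) (at_right 0)" "(G \<longlongrightarrow> Beta a b) (at_left 1)"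
proof -
  define f where "f t = t powr (a - 1) * (1 - t) powr (b - 1)" for t
  have hi: "(f has_integral Beta a b) {0..1}" unfolding f_def by (rule has_integral_Beta_real[OF assms])
  then have io: "f integrable_on {0..1}" by blast
  define G where "G u = integral {0..u} f" for u
  have c: "continuous_on {0..1} G" unfolding G_def by (rule indefinite_integral_continuous_1[OF io])
  have "(G has_real_derivative f u) (at u)" if u: "0 < u" "u < 1" for u
  proof -
    have "(G has_vector_derivative f u) (at u within {0..1})"
    proof -
      have "isCont f u"
        unfolding f_def[abs_def] using u by (intro continuous_intros) auto
      then have "continuous (at u within {0..1} - {}) f"
        by (simp add: continuous_at_imp_continuous_within)
      then show ?thesis
        using integral_has_vector_derivative_continuous_at[OF io, of u "{}"] u by (simp add: G_def[abs_def])
    qed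
    then have "(G has_real_derivative f u) (at u within {0<..<1})"
      unfolding has_real_derivative_iff_has_vector_derivative
      by (rule has_vector_derivative_within_subset) auto
    then show ?thesis using u at_within_open[of u "{0<..<1}"] by simp
  qed
  moreover have "(G \<longlongrightarrow> 0) (at_right 0)"
  proof -
    have "(G \<longlongrightarrow> G 0) (at 0 within {0..1})" using c by (auto simp: continuous_on_def)
    then show ?thesis by (simp add: at_within_Icc_at_right G_def)
  qed
  moreover have "(G \<longlongrightarrow> Beta a b) (at_left 1)"
  proof -
    have "(G \<longlongrightarrow> G 1) (at 1 within {0..1})" using c by (auto simp: continuous_on_def)
    moreover have "G 1 = Beta a b" using hi unfolding G_def by (simp add: integral_unique)
    ultimately show ?thesis by (simp add: at_within_Icc_at_left)
  qed
  ultimately show ?thesis using that unfolding f_def by blast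
qed

text \<open>The bound p > -1/2 controls the singularity x^(2p) at 0, and p < 1/2 the decay x^(2p-2)
  at infinity. The antiderivative \<open>H\<close> has finite limits at both ends: at 0 only the
  term (1 + x)^(2p+1) of \<open>F\<close> survives, at infinity only the Beta value.\<close>

lemma has_bochner_integral_increment_square:
  fixes p :: real assumes p: "-1/2 < p" "p < 1/2"
  shows "has_bochner_integral lborel (\<lambda>x. indicator {0<..} x * ((1 + x) powr p - x powr p)\<^sup>2)
     (((1 - p) * Beta (p + 1) (1 - 2 * p) - 1) / (2 * p + 1))"
proof -
  obtain G where G: "\<And>u. 0 < u \<Longrightarrow> u < 1 \<Longrightarrow> (G has_real_derivative u powr p * (1 - u) powr (-2 * p)) (at u)"
    "(G \<longlongrightarrow> 0) (at_right 0)" "(G \<longlongrightarrow> Beta (p + 1) (1 - 2 * p)) (at_left 1)"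
    using incomplete_Beta[of "p + 1" "1 - 2 * p"] p by auto
  \<comment> \<open>\<open>F\<close> comes from integrating \<open>x\<^sup>p (1 + x)\<^sup>p\<close> by parts twice, until the remaining term
     \<open>x\<^sup>p (1 + x)\<^sup>p\<^sup>-\<^sup>2\<close> is integrable for all admissible \<open>p\<close>; that term becomes a Beta integrand
     in the variable \<open>x / (1 + x)\<close>.\<close>
  define F where "F x = (1 + x) powr (2*p+1) + x powr (2*p+1) - 2 * (x powr (p+1) * (1+x) powr p)
           - x powr (p+1) * (1+x) powr (p-1)" for x :: real
  define H where "H x = (F x + (1 - p) * G (x / (1 + x))) / (2 * p + 1)" for x
  define f where "f x = ((1 + x) powr p - x powr p)\<^sup>2" for x
  have ab: "ereal 0 < \<infinity>" by simp
  have D: "(H has_real_derivative f x) (at x)" if x: "0 < x" for x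
  proof -
    define u where "u = x / (1 + x)"
    have u: "0 < u" "u < 1" using x by (auto simp: u_def)
    have du: "((\<lambda>x. x / (1 + x)) has_real_derivative 1 / (1 + x)\<^sup>2) (at x)"
      using x by (auto intro!: derivative_eq_intros simp: field_simps power2_eq_square)
    have "((\<lambda>x. G (x / (1 + x))) has_real_derivative u powr p * (1 - u) powr (-2 * p) * (1 / (1 + x)\<^sup>2)) (at x)"
      using DERIV_chain2[OF G(1)[OF u, unfolded u_def] du] unfolding u_def .
    moreover have "u powr p * (1 - u) powr (-2 * p) * (1 / (1 + x)\<^sup>2) = x powr p * (1 + x) powr (p - 2)"
    proof -
      have "1 - u = 1 / (1 + x)" using x by (simp add: u_def field_simps)
      then show ?thesis using x
        by (simp add: u_def powr_divide powr_minus powr_diff field_simps flip: powr_add)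
    qed
    ultimately have dG: "((\<lambda>x. G (x / (1 + x))) has_real_derivative x powr p * (1 + x) powr (p - 2)) (at x)" by simp
    have dF: "(F has_real_derivative (2*p+1) * (1 + x) powr (2*p) + (2*p+1) * x powr (2*p)
        - 2 * ((p+1) * x powr p * (1+x) powr p + x powr (p+1) * (p * (1+x) powr (p-1)))
        - ((p+1) * x powr p * (1+x) powr (p-1) + x powr (p+1) * ((p-1) * (1+x) powr (p-2)))) (at x)"
      unfolding F_def[abs_def] using x
      by (auto intro!: derivative_eq_intros simp: algebra_simps)
    \<comment> \<open>Every power in the derivative is a rational function of x times
      \<open>w\<close>, \<open>v\<close> or one of their squares, so the identity to be checked
      becomes a rational one.\<close>
    define w v where "w = (1 + x) powr p" and "v = x powr p"
    have pw: "(1 + x) powr (2*p) = w^2" "x powr (2*p) = v^2" "(1+x) powr (p-1) = w / (1 + x)"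
       "(1+x) powr (p-2) = w / (1 + x)^2" "x powr (p+1) = v * x"
      using x by (simp_all only: w_def v_def mult_2 powr_add power2_eq_square)
         (simp_all add: powr_diff power2_eq_square)
    have "(2*p+1) * (1 + x) powr (2*p) + (2*p+1) * x powr (2*p)
        - 2 * ((p+1) * x powr p * (1+x) powr p + x powr (p+1) * (p * (1+x) powr (p-1)))
        - ((p+1) * x powr p * (1+x) powr (p-1) + x powr (p+1) * ((p-1) * (1+x) powr (p-2)))
        + (1 - p) * (x powr p * (1 + x) powr (p - 2)) = (2 * p + 1) * f x"
      unfolding pw f_def w_def[symmetric] v_def[symmetric] using x
      by (simp add: divide_simps add_eq_0_iff) (simp add: algebra_simps power2_eq_square)
    moreover have "2 * p + 1 \<noteq> 0" using p by simp
    ultimately show ?thesis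
      unfolding H_def[abs_def] using DERIV_cdivide[OF DERIV_add[OF dF DERIV_cmult[OF dG, of "1 - p"]], of "2*p+1"]
      by simp
  qed
  have C: "isCont f x" if "0 < x" for x
    using that unfolding f_def by (auto intro!: continuous_intros)
  have A: "((H \<circ> real_of_ereal) \<longlongrightarrow> 1 / (2 * p + 1)) (at_right (ereal 0))"
  proof -
    have "filterlim (\<lambda>x::real. x / (1 + x)) (at_right 0) (at_right 0)" by real_asymp
    from filterlim_compose[OF G(2) this] have "((\<lambda>x. G (x / (1 + x))) \<longlongrightarrow> 0) (at_right 0)" .
    moreover have "((\<lambda>x. x powr (2*p+1)) \<longlongrightarrow> 0) (at_right 0)" "((\<lambda>x. x powr (p+1)) \<longlongrightarrow> 0) (at_right 0)"
      using p by real_asymp+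
    moreover have "eventually ((\<le>) 0) (at_right (0 :: real))"
      using eventually_at_right_less by eventually_elim simp
    ultimately show ?thesis
      unfolding ereal_tendsto_simps H_def[abs_def] F_def using p
      by (auto intro!: tendsto_eq_intros)
  qed
  have B: "((H \<circ> real_of_ereal) \<longlongrightarrow> (1 - p) * Beta (p + 1) (1 - 2 * p) / (2 * p + 1)) (at_left \<infinity>)"
  proof -
    have "filterlim (\<lambda>x::real. x / (1 + x)) (at_left 1) at_top" by real_asymp
    from filterlim_compose[OF G(3) this]
    have "((\<lambda>x. G (x / (1 + x))) \<longlongrightarrow> Beta (p + 1) (1 - 2 * p)) at_top" .
    moreover have "(F \<longlongrightarrow> 0) at_top"
      unfolding F_def[abs_def] by (rule mandelbrot_van_ness_boundary_term) fact
    ultimately show ?thesis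
      unfolding ereal_tendsto_simps H_def[abs_def] using p
      by (auto intro!: tendsto_eq_intros)
  qed
  have f0: "0 \<le> f x" for x by (simp add: f_def)
  note F = interval_integral_FTC_nonneg[OF ab, of H f, OF _ _ _ A B]
  have "set_integrable lborel (einterval (ereal 0) \<infinity>) f"
    by (rule F(1)) (use D C f0 in auto)
  moreover have "(LBINT x=ereal 0..\<infinity>. f x) = (1 - p) * Beta (p + 1) (1 - 2 * p) / (2 * p + 1) - 1 / (2 * p + 1)"
    by (rule F(2)) (use D C f0 in auto)
  ultimately show ?thesis
    by (simp add: has_bochner_integral_iff set_integrable_def interval_lebesgue_integral_def f_def
          set_lebesgue_integral_def einterval_def diff_divide_distrib flip: greaterThan_def zero_ereal_def)
qed

text \<open>Euler's reflection formula, shifted and cleared of denominators so that it stays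
  meaningful at x = 0, where the sine vanishes.\<close>

lemma Gamma_reflection_real:
  fixes x :: real assumes "\<bar>x\<bar> < 1"
  shows "Gamma (1 + x) * Gamma (1 - x) * sin (pi * x) = pi * x"
proof (cases "x = 0")
  case False
  have "complex_of_real (rGamma x * rGamma (- x)) = complex_of_real (- x * sin (pi * x) / pi)"
    using rGamma_reflection_complex'[of "complex_of_real x"]
    by (simp add: rGamma_complex_of_real sin_of_real flip: of_real_minus of_real_mult of_real_divide)
  then have "rGamma x * rGamma (- x) = - x * sin (pi * x) / pi"
    by (simp only: of_real_eq_iff)
  moreover have "rGamma x = x * rGamma (1 + x)" "rGamma (- x) = - x * rGamma (1 - x)"
    using rGamma_plus1[of x] rGamma_plus1[of "-x"] by (simp_all add: add.commute)
  ultimately have "x * (rGamma (1 + x) * rGamma (1 - x) * (pi * x)) = x * sin (pi * x)"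
    by (simp add: field_simps)
  then have "rGamma (1 + x) * rGamma (1 - x) * (pi * x) = sin (pi * x)"
    using False by simp
  moreover have "Gamma (1 + x) > 0" "Gamma (1 - x) > 0" using assms by (auto intro!: Gamma_real_pos)
  ultimately show ?thesis by (simp add: rGamma_inverse_Gamma field_simps)
qed simp

text \<open>Reflection at p and at 2p gives two formulas whose sines are related by sin(2 pi p) = 2
  sin(pi p) cos(pi p). Cancelling sin(pi p) leaves the cosine; at p = 0 this cancellation is
  impossible and the identity is immediate.\<close>

lemma Beta_mandelbrot_van_ness:
  fixes p :: real assumes p: "-1/2 < p" "p < 1/2"
  shows "(1 - p) * Beta (p + 1) (1 - 2 * p) / (2 * p + 1) = (Gamma (p + 1))\<^sup>2 / (Gamma (2 * p + 2) * cos (pi * p))"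
proof -
  have pos: "Gamma (1 - p) > 0" "Gamma (2 * p + 1) > 0" "Gamma (p + 1) > 0"
    using p by (auto intro!: Gamma_real_pos)
  have c: "cos (pi * p) > 0"
    using mult_strict_left_mono[OF p(1) pi_gt_zero] mult_strict_left_mono[OF p(2) pi_gt_zero]
    by (intro cos_gt_zero_pi) simp_all
  have *: "Gamma (1 - 2 * p) * Gamma (2 * p + 1) * cos (pi * p) = Gamma (p + 1) * Gamma (1 - p)"
  proof (cases "p = 0")
    case False
    have "sin (pi * p) \<noteq> 0"
    proof
      assume "sin (pi * p) = 0"
      then obtain n where "pi * p = real_of_int n * pi" by (auto simp: sin_zero_iff_int2)
      then have "p = real_of_int n" by simp
      then show False using p False by auto
    qed
    moreover have "Gamma (1 - 2 * p) * Gamma (2 * p + 1) * cos (pi * p) * sin (pi * p) 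
        = Gamma (1 + 2 * p) * Gamma (1 - 2 * p) * sin (2 * (pi * p)) / 2"
      unfolding sin_double by (simp add: algebra_simps)
    moreover have "\<dots> = Gamma (1 + p) * Gamma (1 - p) * sin (pi * p)"
      using Gamma_reflection_real[of p] Gamma_reflection_real[of "2 * p"] p
      by (simp add: mult.left_commute)
    ultimately show ?thesis by (simp add: add.commute)
  qed simp
  have np: "1 - p \<notin> \<int>\<^sub>\<le>\<^sub>0" "2 * p + 1 \<notin> \<int>\<^sub>\<le>\<^sub>0"
    using p by (auto elim!: nonpos_Ints_cases)
  have G: "Gamma (2 - p) = (1 - p) * Gamma (1 - p)" "Gamma (2 * p + 2) = (2 * p + 1) * Gamma (2 * p + 1)"
    using Gamma_plus1[OF np(1)] Gamma_plus1[OF np(2)] by (simp_all add: algebra_simps)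
  have "Beta (p + 1) (1 - 2 * p) = Gamma (p + 1) * Gamma (1 - 2 * p) / Gamma (2 - p)"
    by (simp add: Beta_def)
  then have "(1 - p) * Beta (p + 1) (1 - 2 * p) / (2 * p + 1) = Gamma (p + 1) * Gamma (1 - 2 * p) / Gamma (1 - p) / (2 * p + 1)"
    using p unfolding G by simp
  also have "Gamma (p + 1) * Gamma (1 - 2 * p) / Gamma (1 - p) = (Gamma (p + 1))\<^sup>2 / (Gamma (2 * p + 1) * cos (pi * p))"
    using * pos c by (simp add: field_simps power2_eq_square)
  finally show ?thesis unfolding G by (simp add: mult_ac)
qed

text \<open>The kernel vanishes for x > 1 and is a single power on (0,1). On the negative half-line
  it is the reflected increment. The value 1/(2p+1) from (0,1) cancels the same term in the integral
  of the squared increment.\<close>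

lemma has_bochner_integral_kernel_square:
  fixes p :: real assumes p: "-1/2 < p" "p < 1/2"
  shows "has_bochner_integral lborel (\<lambda>x. (pospow p (1 - x) - pospow p (- x))\<^sup>2)
     ((Gamma (p + 1))\<^sup>2 / (Gamma (2 * p + 2) * cos (pi * p)))"
proof -
  define f where "f x = indicator {0<..} x * ((1 + x) powr p - x powr p)\<^sup>2" for x :: real
  define I where "I = ((1 - p) * Beta (p + 1) (1 - 2 * p) - 1) / (2 * p + 1)"
  define g where "g x = indicator {0<..<1} x * x powr (2 * p)" for x :: real
  have g: "has_bochner_integral lborel g (1 / (2*p+1))"
    using has_bochner_integral_powr_head[of 0 1 "2*p+1"] p by (simp add: g_def[abs_def])
  have f: "has_bochner_integral lborel f I"
    unfolding f_def[abs_def] I_def by (rule has_bochner_integral_increment_square[OF p])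
  have "has_bochner_integral lborel (\<lambda>x. g (1 + (-1) * x) + f (0 + (-1) * x)) (1 / (2*p+1) + I)"
    using lborel_has_bochner_integral_real_affine_iff[of "-1" g "1 / (2*p+1)" 1] 
      lborel_has_bochner_integral_real_affine_iff[of "-1" f I 0] g f
    by (intro has_bochner_integral_add) simp_all
  moreover have "AE x in lborel. g (1 + (-1) * x) + f (0 + (-1) * x) = (pospow p (1 - x) - pospow p (- x))\<^sup>2"
    using AE_lborel_singleton[of 0] AE_lborel_singleton[of 1]
  proof eventually_elim
    case (elim x)
    consider "x < 0" | "0 < x" "x < 1" | "1 < x" using elim by force
    then show ?case
    proof cases
      case 1
      then show ?thesis by (simp add: g_def f_def pospow_def)
    next
      case 2
      then have "(1 - x) powr (2 * p) = ((1 - x) powr p)\<^sup>2"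
        by (simp only: mult_2 powr_add power2_eq_square)
      with 2 show ?thesis by (simp add: g_def f_def pospow_def)
    next
      case 3
      then show ?thesis by (simp add: g_def f_def pospow_def)
    qed
  qed
  moreover have "1 / (2*p+1) + I = (Gamma (p + 1))\<^sup>2 / (Gamma (2 * p + 2) * cos (pi * p))"
    unfolding Beta_mandelbrot_van_ness[OF p, symmetric] I_def by (simp add: diff_divide_distrib)
  moreover have "(\<lambda>x. g (1 + (-1) * x) + f (0 + (-1) * x)) \<in> borel_measurable lborel"
    unfolding g_def f_def by measurable
  moreover have "(\<lambda>x. (pospow p (1 - x) - pospow p (- x))\<^sup>2) \<in> borel_measurable lborel"
    unfolding pospow_def by measurable
  ultimately show ?thesis
    using has_bochner_integral_cong_AE[of "\<lambda>x. g (1 + (-1) * x) + f (0 + (-1) * x)" lborel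
      "\<lambda>x. (pospow p (1 - x) - pospow p (- x))\<^sup>2" "1 / (2*p+1) + I"]
    by simp
qed

lemma pospow_scale: "0 < c \<Longrightarrow> pospow p (c * y) = c powr p * pospow p y"
  by (auto simp: pospow_def max_def powr_mult zero_le_mult_iff not_le mult_less_0_iff)

lemma has_bochner_integral_kernel_increment:
  fixes p s t :: real assumes p: "-1/2 < p" "p < 1/2"
  defines "C \<equiv> (Gamma (p + 1))\<^sup>2 / (Gamma (2 * p + 2) * cos (pi * p))"
  shows "has_bochner_integral lborel (\<lambda>x. (pospow p (t - x) - pospow p (s - x))\<^sup>2) (C * \<bar>t - s\<bar> powr (2 * p + 1))"
proof -
  have *: "has_bochner_integral lborel (\<lambda>x. (pospow p (t - x) - pospow p (s - x))\<^sup>2) (C * (t - s) powr (2 * p + 1))"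
    if "s < t" for s t :: real
  proof -
    define c where "c = t - s"
    have c: "0 < c" using that by (simp add: c_def)
    have e: "t - (s + c * y) = c * (1 - y)" "s - (s + c * y) = c * (- y)" for y 
      by (simp_all add: c_def algebra_simps)
    have "has_bochner_integral lborel (\<lambda>y. (c powr p)\<^sup>2 * (pospow p (1 - y) - pospow p (- y))\<^sup>2) ((c powr p)\<^sup>2 * C)"
      unfolding C_def by (intro has_bochner_integral_mult_right has_bochner_integral_kernel_square p)
    also have "(\<lambda>y. (c powr p)\<^sup>2 * (pospow p (1 - y) - pospow p (- y))\<^sup>2) = 
      (\<lambda>y. (pospow p (t - (s + c * y)) - pospow p (s - (s + c * y)))\<^sup>2)"
      unfolding e pospow_scale[OF c] by (simp add: algebra_simps power2_eq_square)
    also have "(c powr p)\<^sup>2 * C = (C * c powr (2 * p + 1)) /\<^sub>R \<bar>c\<bar>"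
    proof -
      have "c powr (2 * p + 1) = (c powr p)\<^sup>2 * c"
        using c by (simp only: mult_2 powr_add power2_eq_square powr_one)
      then show ?thesis using c by simp
    qed
    finally show ?thesis
      using lborel_has_bochner_integral_real_affine_iff[of c "\<lambda>x. (pospow p (t - x) - pospow p (s - x))\<^sup>2" "C * c powr (2 * p + 1)" s] c
      by (simp add: c_def)
  qed
  consider "s < t" | "s = t" | "t < s" by linarith
  then show ?thesis
  proof cases
    case 3
    then show ?thesis using *[OF 3] by (simp add: power2_commute)
  qed (use * has_bochner_integral_zero in auto)
qed

text \<open>The term \<open>pospow p (- x)\<close> is common to both times and drops out of the
  difference, so the increments are stationary.\<close>

lemma has_bochner_integral_M_minus_increment:
  assumes \<alpha>: "0 < \<alpha>" "\<alpha> < 2" and t: "0 \<le> t" and s: "0 \<le> s"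
  shows "has_bochner_integral lborel (\<lambda>x. (M_minus \<alpha> (indicator {0..<t}) x - M_minus \<alpha> (indicator {0..<s}) x)\<^sup>2)
    (\<bar>t - s\<bar> powr \<alpha>)"
proof -
  define p where "p = (\<alpha> - 1) / 2"
  have p: "-1/2 < p" "p < 1/2" using \<alpha> by (auto simp: p_def)
  define C where "C = (Gamma (p + 1))\<^sup>2 / (Gamma (2 * p + 2) * cos (pi * p))"
  define K where "K = M_const \<alpha> / Gamma ((\<alpha> + 1) / 2)"
  have k: "M_minus \<alpha> (indicator {0..<u}) x = K * (pospow p (u - x) - pospow p (- x))" if "0 \<le> u" for u x
    unfolding K_def p_def by (rule M_minus_indicator[OF \<alpha> that])
  have e: "(M_minus \<alpha> (indicator {0..<t}) x - M_minus \<alpha> (indicator {0..<s}) x)\<^sup>2 = 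
     K\<^sup>2 * (pospow p (t - x) - pospow p (s - x))\<^sup>2" for x
    unfolding k[OF t] k[OF s] by (simp flip: power_mult_distrib right_diff_distrib)
  have "has_bochner_integral lborel (\<lambda>x. K\<^sup>2 * (pospow p (t - x) - pospow p (s - x))\<^sup>2) (K\<^sup>2 * (C * \<bar>t - s\<bar> powr (2 * p + 1)))"
    unfolding C_def by (intro has_bochner_integral_mult_right has_bochner_integral_kernel_increment p)
  moreover have "K\<^sup>2 * (C * \<bar>t - s\<bar> powr (2 * p + 1)) = \<bar>t - s\<bar> powr \<alpha>"
  proof -
    have "0 < \<alpha> * pi / 2" "\<alpha> * pi / 2 < pi" using \<alpha> by (simp_all add: field_simps)
    then have sp: "0 < sin (\<alpha> * pi / 2)" by (rule sin_gt_zero)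
    have "cos (pi * p) = cos (\<alpha> * pi / 2 - pi / 2)" by (simp add: p_def field_simps)
    also have "\<dots> = sin (\<alpha> * pi / 2)" by (simp add: cos_diff)
    finally have c: "cos (pi * p) = sin (\<alpha> * pi / 2)" .
    have g: "2 * p + 2 = \<alpha> + 1" "p + 1 = (\<alpha> + 1) / 2" "2 * p + 1 = \<alpha>" by (simp_all add: p_def field_simps)
    have "\<alpha> \<notin> \<int>\<^sub>\<le>\<^sub>0" using \<alpha> by (auto elim!: nonpos_Ints_cases)
    then have G: "Gamma (\<alpha> + 1) = \<alpha> * Gamma \<alpha>" by (rule Gamma_plus1)
    have pos: "Gamma \<alpha> > 0" "Gamma ((\<alpha> + 1) / 2) > 0" using \<alpha> by (auto intro!: Gamma_real_pos)
    have "K\<^sup>2 = \<alpha> * sin (\<alpha> * pi / 2) * Gamma \<alpha> / (Gamma ((\<alpha> + 1) / 2))\<^sup>2"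
      unfolding K_def M_const_def power_divide using \<alpha> sp pos by (subst real_sqrt_pow2) auto
    moreover have "Gamma \<alpha> \<noteq> 0" "Gamma ((\<alpha> + 1) / 2) \<noteq> 0" using pos by linarith+
    \<comment> \<open>The origin of \<open>M_const\<close>: by cos(pi p) = sin(\<alpha> pi / 2) and
      Gamma(2p + 2) = \<alpha> Gamma(\<alpha>), its square is exactly the denominator of
      \<open>C\<close>, and the factor Gamma(p + 1)^2 cancels against the one in
      \<open>K\<close>.\<close>
    ultimately have "K\<^sup>2 * C = 1"
      unfolding C_def c g G using sp \<alpha> by simp
    then show ?thesis unfolding g by (simp add: mult.assoc[symmetric])
  qed
  ultimately show ?thesis by (simp only: e)
qed

lemma M_minus_indicator_empty: "0 < \<alpha> \<Longrightarrow> \<alpha> < 2 \<Longrightarrow> M_minus \<alpha> (indicator {0..<0}) x = 0"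
  by (subst M_minus_indicator) auto

lemma has_bochner_integral_M_minus_product:
  assumes \<alpha>: "0 < \<alpha>" "\<alpha> < 2" and t: "0 \<le> t" and s: "0 \<le> s"
  shows "has_bochner_integral lborel (\<lambda>x. M_minus \<alpha> (indicator {0..<t}) x * M_minus \<alpha> (indicator {0..<s}) x)
    ((t powr \<alpha> + s powr \<alpha> - \<bar>t - s\<bar> powr \<alpha>) / 2)"
proof -
  let ?k = "\<lambda>t. M_minus \<alpha> (indicator {0..<t})"
  have sq: "has_bochner_integral lborel (\<lambda>x. (?k t x)\<^sup>2) (t powr \<alpha>)" if "0 \<le> t" for t
    using has_bochner_integral_M_minus_increment[OF \<alpha> that order_refl] that 
    unfolding M_minus_indicator_empty[OF \<alpha>] by simp
  have "has_bochner_integral lborel (\<lambda>x. ((?k t x)\<^sup>2 + (?k s x)\<^sup>2 - (?k t x - ?k s x)\<^sup>2) / 2)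
    ((t powr \<alpha> + s powr \<alpha> - \<bar>t - s\<bar> powr \<alpha>) / 2)"
    by (intro has_bochner_integral_divide_zero has_bochner_integral_diff has_bochner_integral_add sq
        has_bochner_integral_M_minus_increment \<alpha> t s)
  then show ?thesis by (simp add: power2_diff)
qed

section \<open>The Mittag-Leffler function\<close>

text \<open>Only the part of the Gamma integral over [T, T + 1] is kept. Since \<open>T\<close> is
  free, Gamma(\<beta>n + 1) outgrows every geometric sequence in n.\<close>

lemma Gamma_ge_powr:
  fixes s T :: real assumes s: "0 \<le> s" and T: "0 < T"
  shows "T powr s * exp (- (T + 1)) \<le> Gamma (s + 1)"
proof (rule has_integral_le)
  define c where "c = T powr s * exp (- (T + 1))"
  have "((\<lambda>_. c) has_integral c) {T..T+1}"
    using has_integral_const_real[of c T "T + 1"] by simp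
  then show "((\<lambda>t. if t \<in> {T..T+1} then c else 0) has_integral c) {0..}"
    using T by (subst has_integral_restrict) auto
  show "((\<lambda>t. t powr s / exp t) has_integral Gamma (s + 1)) {0..}"
    using Gamma_integral_real[of "s + 1"] s by simp
  show "(if t \<in> {T..T+1} then c else 0) \<le> t powr s / exp t" for t
  proof (cases "t \<in> {T..T+1}")
    case True
    then have "T powr s * exp (- (T + 1)) \<le> t powr s * exp (- t)"
      using s T by (intro mult_mono powr_mono2) auto
    then show ?thesis using True by (simp add: c_def exp_minus field_simps)
  qed (use s in auto)
qed

lemma summable_mittag_leffler:
  fixes z :: "'a::{real_normed_field, banach}" assumes \<beta>: "0 < \<beta>"
  shows "summable (\<lambda>n. z ^ n / of_real (Gamma (\<beta> * real n + 1)))"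
proof -
  \<comment> \<open>Chosen to make T^\<beta> = 2|z| + 1, so that the terms are bounded by a
    geometric series of ratio below 1. The summand 1 keeps \<open>T\<close> positive at z =
    0.\<close>
  define T where "T = (2 * norm z + 1) powr (1 / \<beta>)"
  have nz: "0 < 2 * norm z + 1" by (rule add_nonneg_pos) auto
  have T: "0 < T" "T powr \<beta> = 2 * norm z + 1"
    using \<beta> nz by (auto simp: T_def powr_powr)
  have "norm z / (2 * norm z + 1) < 1"
    using norm_ge_zero[of z] unfolding divide_less_eq_1_pos[OF nz] by linarith
  moreover have "0 \<le> norm z / (2 * norm z + 1)"
    by (rule divide_nonneg_pos[OF norm_ge_zero nz])
  ultimately have "summable (\<lambda>n. exp (T + 1) * (norm z / (2 * norm z + 1)) ^ n)"
    by (intro summable_mult summable_geometric) (simp only: real_norm_def abs_of_nonneg)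
  moreover have "norm (z ^ n / of_real (Gamma (\<beta> * real n + 1))) \<le> exp (T + 1) * (norm z / (2 * norm z + 1)) ^ n" for n
  proof -
    have "(2 * norm z + 1) ^ n = T powr (\<beta> * real n)"
      using T norm_ge_zero[of z] by (simp add: powr_powr[symmetric] powr_realpow add_nonneg_pos del: norm_ge_zero)
    then have "(2 * norm z + 1) ^ n * exp (- (T + 1)) \<le> Gamma (\<beta> * real n + 1)"
      using Gamma_ge_powr[of "\<beta> * real n" T] \<beta> T by simp
    then have "(2 * norm z + 1) ^ n \<le> exp (T + 1) * Gamma (\<beta> * real n + 1)"
      using mult_left_mono[of "(2 * norm z + 1) ^ n * exp (- (T + 1))" _ "exp (T + 1)"]
      unfolding exp_minus by (simp add: mult.left_commute[of "exp (T + 1)"])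
    moreover have "0 < Gamma (\<beta> * real n + 1)" 
      using \<beta> by (intro Gamma_real_pos) (simp add: add_nonneg_pos)
    moreover have "0 < (2 * norm z + 1) ^ n" using norm_ge_zero[of z] by (simp add: add_nonneg_pos del: norm_ge_zero)
    ultimately have "1 / Gamma (\<beta> * real n + 1) \<le> exp (T + 1) / (2 * norm z + 1) ^ n"
      by (simp add: field_simps)
    from mult_left_mono[OF this, of "norm z ^ n"] show ?thesis
      using \<open>0 < Gamma _\<close> by (simp add: norm_divide norm_power power_divide mult_ac)
  qed
  ultimately show ?thesis by (rule summable_comparison_test'[where N=0])
qed

definition mittag_leffler_real :: "real \<Rightarrow> real \<Rightarrow> real" where
  "mittag_leffler_real \<beta> u = (\<Sum>n. u ^ n / Gamma (\<beta> * real n + 1))"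

lemma mittag_leffler_of_real:
  assumes "0 < \<beta>"
  shows "mittag_leffler \<beta> (of_real u) = of_real (mittag_leffler_real \<beta> u)"
  using suminf_of_real[OF summable_mittag_leffler[OF assms, of u], where 'a=complex]
  unfolding mittag_leffler_def mittag_leffler_real_def by simp

lemma isCont_mittag_leffler_real:
  assumes "0 < \<beta>"
  shows "isCont (mittag_leffler_real \<beta>) u"
  using isCont_powser_converges_everywhere[of "\<lambda>n. 1 / Gamma (\<beta> * real n + 1)" u]
    summable_mittag_leffler[OF assms, where 'a=real]
  unfolding mittag_leffler_real_def[abs_def] by simp

lemma mittag_leffler_real_1: "mittag_leffler_real 1 u = exp u"
  unfolding mittag_leffler_real_def exp_def
  by (simp add: Gamma_fact[symmetric] add.commute divide_inverse_commute)

text \<open>The remainder after two terms is u^2 times another everywhere convergent power series.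
  Its continuity at 0 gives access to the second coefficient without differentiating
  E_\<beta>.\<close>

lemma mittag_leffler_real_second_order:
  assumes \<beta>: "0 < \<beta>"
  obtains h where "\<And>u. mittag_leffler_real \<beta> u = 1 + u / Gamma (\<beta> + 1) + u\<^sup>2 * h u"
    "isCont h 0" "h 0 = 1 / Gamma (2 * \<beta> + 1)"
proof -
  define c where "c n = 1 / Gamma (\<beta> * real n + 1)" for n
  have S: "summable (\<lambda>n. c n * u ^ n)" for u
    using summable_mittag_leffler[OF \<beta>, of u] by (simp add: c_def)
  have S2: "summable (\<lambda>n. c (n + 2) * u ^ n)" for u
    using powser_split_head(3)[OF powser_split_head(3)[OF S[of u]]] by (simp add: numeral_2_eq_2)
  define h where "h u = (\<Sum>n. c (n + 2) * u ^ n)" for u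
  have "mittag_leffler_real \<beta> u = 1 + u / Gamma (\<beta> + 1) + u\<^sup>2 * h u" for u
  proof -
    have "mittag_leffler_real \<beta> u = (\<Sum>n. c n * u ^ n)"
      by (simp add: mittag_leffler_real_def c_def)
    also have "\<dots> = (\<Sum>n. c (n + 2) * u ^ (n + 2)) + (\<Sum>n<2. c n * u ^ n)"
      by (rule suminf_split_initial_segment[OF S])
    also have "(\<Sum>n. c (n + 2) * u ^ (n + 2)) = u\<^sup>2 * h u"
      unfolding h_def using suminf_mult[OF S2[of u], of "u\<^sup>2"] by (simp add: power_add mult_ac power2_eq_square)
    also have "(\<Sum>n<2. c n * u ^ n) = 1 + u / Gamma (\<beta> + 1)"
      by (simp add: c_def numeral_2_eq_2)
    finally show ?thesis by simp
  qed
  moreover have "isCont h 0"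
    unfolding h_def[abs_def] by (rule isCont_powser_converges_everywhere[OF S2])
  moreover have "h 0 = 1 / Gamma (2 * \<beta> + 1)"
    unfolding h_def using powser_zero[of "\<lambda>n. c (n + 2)"] by (simp add: c_def mult.commute)
  ultimately show ?thesis using that by blast
qed

lemma Gamma_eq_two_square_imp_one:
  fixes \<beta> :: real assumes \<beta>: "0 < \<beta>" "\<beta> \<le> 1" and eq: "Gamma (2 * \<beta> + 1) = 2 * (Gamma (\<beta> + 1))\<^sup>2"
  shows "\<beta> = 1"
proof (rule ccontr)
  assume "\<beta> \<noteq> 1"
  then have lt: "\<beta> < 1" using \<beta> by simp
  \<comment> \<open>The logarithm of Gamma(2x + 1) / Gamma(x + 1)^2, a ratio that equals 2 at x = 1.
    Its derivative compares \<open>Digamma\<close> at 2x + 1 and at x + 1.\<close>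
  define f where "f x = ln_Gamma (2 * x + 1) - 2 * ln_Gamma (x + 1)" for x :: real
  have "f \<beta> < f 1"
  proof (rule DERIV_pos_imp_increasing[OF lt])
    fix x assume x: "\<beta> \<le> x" "x \<le> 1"
    have "(f has_real_derivative 2 * Digamma (2 * x + 1) - 2 * Digamma (x + 1)) (at x)"
      unfolding f_def[abs_def] using x \<beta> by (auto intro!: derivative_eq_intros)
    moreover have "Digamma (x + 1) < Digamma (2 * x + 1)"
      using x \<beta> by (intro Digamma_real_strict_mono) auto
    ultimately show "\<exists>y. (f has_real_derivative y) (at x) \<and> 0 < y" by force
  qed
  moreover have "exp (f x) = Gamma (2 * x + 1) / (Gamma (x + 1))\<^sup>2" if "0 < x" for x
    using that by (simp add: f_def exp_diff exp_double Gamma_real_pos_exp)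
  ultimately have "Gamma (2 * \<beta> + 1) / (Gamma (\<beta> + 1))\<^sup>2 < Gamma (2 * 1 + 1) / (Gamma (1 + 1))\<^sup>2"
    using \<beta> by (metis exp_less_mono zero_less_one)
  moreover have "Gamma (2 * 1 + 1 :: real) = 2" "Gamma (1 + 1 :: real) = 1"
    using Gamma_fact[of 2, where 'a=real] Gamma_fact[of 1, where 'a=real] by (simp_all add: fact_numeral)
  moreover have "0 < Gamma (\<beta> + 1)" using \<beta> by (intro Gamma_real_pos) simp
  ultimately show False unfolding eq by (simp add: field_simps)
qed

lemma mittag_leffler_multiplicative_imp_one:
  assumes \<beta>: "0 < \<beta>" "\<beta> \<le> 1"
    and mult: "\<And>x. 0 < x \<Longrightarrow> mittag_leffler_real \<beta> (- (2 * x)) = (mittag_leffler_real \<beta> (- x))\<^sup>2"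
  shows "\<beta> = 1"
proof -
  obtain h where h: "\<And>u. mittag_leffler_real \<beta> u = 1 + u / Gamma (\<beta> + 1) + u\<^sup>2 * h u"
    "isCont h 0" "h 0 = 1 / Gamma (2 * \<beta> + 1)"
    using mittag_leffler_real_second_order[OF \<beta>(1)] by blast
  define a where "a = 1 / Gamma (\<beta> + 1)"
  \<comment> \<open>The constant terms and the terms -2ax agree on both sides, so x^2 can be divided
    out; letting x tend to 0 from the right then isolates the second coefficients.\<close>
  have eq: "4 * h (- (2 * x)) = a\<^sup>2 + 2 * h (- x) - 2 * a * x * h (- x) + x\<^sup>2 * (h (- x))\<^sup>2" if x: "0 < x" for x
  proof -
    have "1 - 2 * x * a + 4 * x\<^sup>2 * h (- (2 * x)) = (1 - x * a + x\<^sup>2 * h (- x))\<^sup>2"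
      using mult[OF x] unfolding h(1) a_def by simp
    then have "x\<^sup>2 * (4 * h (- (2 * x))) = x\<^sup>2 * (a\<^sup>2 + 2 * h (- x) - 2 * a * x * h (- x) + x\<^sup>2 * (h (- x))\<^sup>2)"
      by (simp add: power2_eq_square algebra_simps)
    then show ?thesis using x by simp
  qed
  have c: "((\<lambda>x. h (- (k * x))) \<longlongrightarrow> h 0) (at_right 0)" for k
  proof -
    have "((\<lambda>x::real. - (k * x)) \<longlongrightarrow> 0) (at_right 0)" by (auto intro!: tendsto_eq_intros)
    then show ?thesis by (rule isCont_tendsto_compose[OF h(2)])
  qed
  have "((\<lambda>x. 4 * h (- (2 * x))) \<longlongrightarrow> 4 * h 0) (at_right 0)"
    by (intro tendsto_intros c)
  moreover have "((\<lambda>x. 4 * h (- (2 * x))) \<longlongrightarrow> a\<^sup>2 + 2 * h 0 - 2 * a * 0 * h 0 + 0\<^sup>2 * (h 0)\<^sup>2) (at_right 0)"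
  proof (rule Lim_transform_eventually)
    show "((\<lambda>x. a\<^sup>2 + 2 * h (- x) - 2 * a * x * h (- x) + x\<^sup>2 * (h (- x))\<^sup>2) \<longlongrightarrow>
       a\<^sup>2 + 2 * h 0 - 2 * a * 0 * h 0 + 0\<^sup>2 * (h 0)\<^sup>2) (at_right 0)"
      using c[of 1] by (intro tendsto_intros) simp_all
    show "\<forall>\<^sub>F x in at_right 0. a\<^sup>2 + 2 * h (- x) - 2 * a * x * h (- x) + x\<^sup>2 * (h (- x))\<^sup>2 = 4 * h (- (2 * x))"
      using eventually_at_right_less by eventually_elim (simp add: eq)
  qed
  ultimately have "4 * h 0 = a\<^sup>2 + 2 * h 0 - 2 * a * 0 * h 0 + 0\<^sup>2 * (h 0)\<^sup>2"
    by (intro tendsto_unique) auto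
  then have "2 * (1 / Gamma (2 * \<beta> + 1)) = (1 / Gamma (\<beta> + 1))\<^sup>2" unfolding h(3) a_def by simp
  moreover have "0 < Gamma (\<beta> + 1)" "0 < Gamma (2 * \<beta> + 1)" using \<beta> by (auto intro!: Gamma_real_pos)
  ultimately have "Gamma (2 * \<beta> + 1) = 2 * (Gamma (\<beta> + 1))\<^sup>2" 
    by (simp add: field_simps power2_eq_square)
  then show ?thesis by (rule Gamma_eq_two_square_imp_one[OF \<beta>])
qed

section \<open>Pairings as \<open>L\<^sup>2\<close> limits\<close>

lemma schwartz_add:
  assumes f: "f \<in> schwartz" and g: "g \<in> schwartz"
  shows "(\<lambda>x. f x + g x) \<in> schwartz"
proof -
  have eq: "(deriv ^^ n) (\<lambda>x. f x + g x) = (\<lambda>x. (deriv ^^ n) f x + (deriv ^^ n) g x)" for n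
  proof (induction n)
    case (Suc n)
    have "deriv (\<lambda>x. (deriv ^^ n) f x + (deriv ^^ n) g x) x = deriv ((deriv ^^ n) f) x + deriv ((deriv ^^ n) g) x" for x
      using f g by (intro deriv_add) (auto simp: schwartz_def)
    then show ?case by (simp add: Suc)
  qed simp
  show ?thesis
    using f g bounded_plus_comp[of "\<lambda>x. x ^ k * (deriv ^^ n) f x" UNIV "\<lambda>x. x ^ k * (deriv ^^ n) g x" for k n]
    by (auto simp: schwartz_def eq distrib_left intro!: field_differentiable_add)
qed

lemma schwartz_cmult:
  assumes f: "f \<in> schwartz"
  shows "(\<lambda>x. c * f x) \<in> schwartz"
proof -
  have eq: "(deriv ^^ n) (\<lambda>x. c * f x) = (\<lambda>x. c * (deriv ^^ n) f x)" for n
  proof (induction n)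
    case (Suc n)
    have "deriv (\<lambda>x. c * (deriv ^^ n) f x) x = c * deriv ((deriv ^^ n) f) x" for x
      using f by (intro deriv_cmult) (auto simp: schwartz_def)
    then show ?case by (simp add: Suc)
  qed simp
  have "bounded (range (\<lambda>x. x ^ k * (c * (deriv ^^ n) f x)))" for k n
    using f bounded_scaleR_comp[of "\<lambda>x. x ^ k * (deriv ^^ n) f x" UNIV c] 
    by (auto simp: schwartz_def mult.left_commute)
  then show ?thesis
    using f by (auto simp: schwartz_def eq intro!: field_differentiable_mult)
qed

lemma schwartz_zero: "(\<lambda>x. 0) \<in> schwartz"
proof -
  have "(deriv ^^ n) (\<lambda>x. 0) = (\<lambda>x. 0 :: real)" for n by (induction n) auto
  then show ?thesis by (auto simp: schwartz_def)
qed

lemma schwartz_vec_add: "\<phi> \<in> schwartz_vec \<Longrightarrow> \<psi> \<in> schwartz_vec \<Longrightarrow> (\<lambda>x. \<phi> x + \<psi> x) \<in> schwartz_vec"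
  by (auto simp: schwartz_vec_def intro!: schwartz_add)

lemma schwartz_vec_scaleR: "\<phi> \<in> schwartz_vec \<Longrightarrow> (\<lambda>x. c *\<^sub>R \<phi> x) \<in> schwartz_vec"
  by (auto simp: schwartz_vec_def intro!: schwartz_cmult)

lemma schwartz_vec_zero: "(\<lambda>x. 0) \<in> schwartz_vec"
  by (auto simp: schwartz_vec_def schwartz_zero)

section \<open>Square-integrable functions and their limits\<close>

lemma norm_add_power2_le: "(norm (a + b))\<^sup>2 \<le> 2 * (norm a)\<^sup>2 + 2 * (norm (b::'a::real_normed_vector))\<^sup>2"
proof -
  have "(norm (a + b))\<^sup>2 \<le> (norm a + norm b)\<^sup>2"
    by (intro power_mono norm_triangle_ineq) simp
  also have "\<dots> \<le> 2 * (norm a)\<^sup>2 + 2 * (norm b)\<^sup>2"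
    using sum_squares_bound[of "norm a" "norm b"] by (simp add: power2_sum)
  finally show ?thesis .
qed

lemma L2_space_add:
  fixes f g :: "'a \<Rightarrow> 'b::{second_countable_topology, real_normed_vector}"
  assumes f: "f \<in> L2_space M" and g: "g \<in> L2_space M"
  shows "(\<lambda>x. f x + g x) \<in> L2_space M"
proof -
  have [measurable]: "f \<in> borel_measurable M" "g \<in> borel_measurable M"
    using f g by (auto simp: L2_space_def)
  have "integrable M (\<lambda>x. (norm (f x + g x))\<^sup>2)"
  proof (rule Bochner_Integration.integrable_bound)
    show "integrable M (\<lambda>x. 2 * (norm (f x))\<^sup>2 + 2 * (norm (g x))\<^sup>2)"
      using f g by (auto simp: L2_space_def)
  qed (use norm_add_power2_le in auto)
  then show ?thesis by (simp add: L2_space_def)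
qed

lemma L2_space_scaleR:
  fixes f :: "'a \<Rightarrow> 'b::{second_countable_topology, real_normed_vector}"
  assumes "f \<in> L2_space M"
  shows "(\<lambda>x. c *\<^sub>R f x) \<in> L2_space M"
  using assms by (auto simp: L2_space_def power_mult_distrib)

lemma L2_space_diff:
  fixes f g :: "'a \<Rightarrow> 'b::{second_countable_topology, real_normed_vector}"
  assumes "f \<in> L2_space M" "g \<in> L2_space M"
  shows "(\<lambda>x. f x - g x) \<in> L2_space M"
  using L2_space_add[OF assms(1) L2_space_scaleR[OF assms(2), of "-1"]] by simp

lemma L2_norm_power2: "(L2_norm M f)\<^sup>2 = (\<integral>x. (norm (f x))\<^sup>2 \<partial>M)"
  unfolding L2_norm_def by (rule real_sqrt_pow2) simp

lemma L2_norm_nonneg: "0 \<le> L2_norm M f"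
  unfolding L2_norm_def by simp

lemma L2_tendsto_iff:
  "L2_tendsto M f g \<longleftrightarrow> (\<forall>n. f n \<in> L2_space M) \<and> g \<in> L2_space M \<and>
     (\<lambda>n. \<integral>x. (norm (f n x - g x))\<^sup>2 \<partial>M) \<longlonglongrightarrow> 0"
proof -
  have "(\<lambda>n. L2_norm M (\<lambda>x. f n x - g x)) \<longlonglongrightarrow> 0 \<longleftrightarrow> (\<lambda>n. (L2_norm M (\<lambda>x. f n x - g x))\<^sup>2) \<longlonglongrightarrow> 0"
    using tendsto_power[of "\<lambda>n. L2_norm M (\<lambda>x. f n x - g x)" 0 sequentially 2]
      tendsto_real_sqrt[of "\<lambda>n. (L2_norm M (\<lambda>x. f n x - g x))\<^sup>2" 0 sequentially]
    by (auto simp: L2_norm_nonneg)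
  then show ?thesis by (simp add: L2_tendsto_def L2_norm_power2)
qed

text \<open>The pointwise bound |a + b|^2 \<le> 2|a|^2 + 2|b|^2 takes the place of Minkowski's
  inequality; the factor 2 is harmless for a limit 0.\<close>

lemma L2_tendsto_add:
  fixes f g :: "nat \<Rightarrow> 'a \<Rightarrow> 'b::{second_countable_topology, real_normed_vector}"
  assumes f: "L2_tendsto M f f'" and g: "L2_tendsto M g g'"
  shows "L2_tendsto M (\<lambda>n x. f n x + g n x) (\<lambda>x. f' x + g' x)"
proof -
  have int: "integrable M (\<lambda>x. (norm (f n x - f' x))\<^sup>2)" "integrable M (\<lambda>x. (norm (g n x - g' x))\<^sup>2)" 
    "integrable M (\<lambda>x. (norm (f n x + g n x - (f' x + g' x)))\<^sup>2)" for n
    using L2_space_diff[of "f n" M f'] L2_space_diff[of "g n" M g'] 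
      L2_space_diff[of "\<lambda>x. f n x + g n x" M "\<lambda>x. f' x + g' x"] L2_space_add[of "f n" M "g n"]
      L2_space_add[of "f'" M "g'"] f g
    by (auto simp: L2_tendsto_def L2_space_def)
  have "(\<lambda>n. \<integral>x. (norm (f n x + g n x - (f' x + g' x)))\<^sup>2 \<partial>M) \<longlonglongrightarrow> 0"
  proof (rule tendsto_sandwich[OF _ _ tendsto_const])
    show "(\<lambda>n. 2 * (\<integral>x. (norm (f n x - f' x))\<^sup>2 \<partial>M) + 2 * (\<integral>x. (norm (g n x - g' x))\<^sup>2 \<partial>M)) \<longlonglongrightarrow> 0"
      using f g by (auto simp: L2_tendsto_iff intro!: tendsto_eq_intros)
    have "(\<integral>x. (norm (f n x + g n x - (f' x + g' x)))\<^sup>2 \<partial>M) \<le>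
      (\<integral>x. 2 * (norm (f n x - f' x))\<^sup>2 + 2 * (norm (g n x - g' x))\<^sup>2 \<partial>M)" for n
    proof (rule integral_mono)
      fix x
      show "(norm (f n x + g n x - (f' x + g' x)))\<^sup>2 \<le> 2 * (norm (f n x - f' x))\<^sup>2 + 2 * (norm (g n x - g' x))\<^sup>2"
        using norm_add_power2_le[of "f n x - f' x" "g n x - g' x"] by (simp add: algebra_simps)
    qed (use int in auto)
    then show "\<forall>\<^sub>F n in sequentially. (\<integral>x. (norm (f n x + g n x - (f' x + g' x)))\<^sup>2 \<partial>M) \<le>
      2 * (\<integral>x. (norm (f n x - f' x))\<^sup>2 \<partial>M) + 2 * (\<integral>x. (norm (g n x - g' x))\<^sup>2 \<partial>M)"
      using int by simp
  qed simp
  then show ?thesis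
    using f g by (auto simp: L2_tendsto_iff intro!: L2_space_add)
qed

lemma L2_tendsto_scaleR:
  fixes f :: "nat \<Rightarrow> 'a \<Rightarrow> 'b::{second_countable_topology, real_normed_vector}"
  assumes f: "L2_tendsto M f f'"
  shows "L2_tendsto M (\<lambda>n x. c *\<^sub>R f n x) (\<lambda>x. c *\<^sub>R f' x)"
proof -
  have "(norm (c *\<^sub>R f n x - c *\<^sub>R f' x))\<^sup>2 = c\<^sup>2 * (norm (f n x - f' x))\<^sup>2" for n x
    by (simp add: power_mult_distrib flip: scaleR_diff_right)
  then show ?thesis
    using f unfolding L2_tendsto_iff by (auto intro!: L2_space_scaleR tendsto_eq_intros)
qed

text \<open>Agreement is asked on the space of \<open>M\<close> alone, because functionals are
  linear only when they belong to \<open>tempered\<close>, the space of \<mu>.\<close>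

lemma L2_tendsto_cong:
  assumes "\<And>n x. x \<in> space M \<Longrightarrow> f n x = g n x" "\<And>x. x \<in> space M \<Longrightarrow> f' x = g' x"
  shows "L2_tendsto M f f' \<longleftrightarrow> L2_tendsto M g g'"
proof -
  have "f n \<in> L2_space M \<longleftrightarrow> g n \<in> L2_space M" for n
    unfolding L2_space_def using assms by (auto simp: cong: measurable_cong Bochner_Integration.integrable_cong)
  moreover have "f' \<in> L2_space M \<longleftrightarrow> g' \<in> L2_space M" for n
    unfolding L2_space_def using assms by (auto simp: cong: measurable_cong Bochner_Integration.integrable_cong)
  moreover have "(\<integral>x. (norm (f n x - f' x))\<^sup>2 \<partial>M) = (\<integral>x. (norm (g n x - g' x))\<^sup>2 \<partial>M)" for n
    using assms by (intro Bochner_Integration.integral_cong) auto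
  ultimately show ?thesis by (simp add: L2_tendsto_iff)
qed

text \<open>Young's inequality with a free weight \<delta>, applied to the cross term 2|b|d, where d
  is the difference of the norms.\<close>

lemma norm_power2_diff_le:
  fixes a b :: "'a::real_normed_vector" assumes "0 < \<delta>"
  shows "\<bar>(norm a)\<^sup>2 - (norm b)\<^sup>2\<bar> \<le> (1 + 1 / \<delta>) * (norm (a - b))\<^sup>2 + \<delta> * (norm b)\<^sup>2"
proof -
  define d where "d = \<bar>norm a - norm b\<bar>"
  have d: "0 \<le> d" "d \<le> norm (a - b)" unfolding d_def by (auto intro: norm_triangle_ineq3)
  have "\<bar>(norm a)\<^sup>2 - (norm b)\<^sup>2\<bar> = \<bar>(norm a - norm b)\<^sup>2 + 2 * norm b * (norm a - norm b)\<bar>"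
    by (simp add: power2_eq_square algebra_simps)
  also have "\<dots> \<le> d\<^sup>2 + 2 * norm b * d"
    unfolding d_def by (intro order_trans[OF abs_triangle_ineq]) (simp add: abs_mult)
  also have "2 * norm b * d \<le> \<delta> * (norm b)\<^sup>2 + (1 / \<delta>) * d\<^sup>2"
  proof -
    have "0 \<le> (\<delta> * norm b - d)\<^sup>2 / \<delta>" using assms by simp
    also have "\<dots> = \<delta> * (norm b)\<^sup>2 + (1 / \<delta>) * d\<^sup>2 - 2 * norm b * d"
      using assms by (simp add: power2_eq_square field_simps)
    finally show ?thesis by simp
  qed
  also have "d\<^sup>2 + (\<delta> * (norm b)\<^sup>2 + (1 / \<delta>) * d\<^sup>2) = (1 + 1 / \<delta>) * d\<^sup>2 + \<delta> * (norm b)\<^sup>2"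
    by (simp add: algebra_simps)
  also have "\<dots> \<le> (1 + 1 / \<delta>) * (norm (a - b))\<^sup>2 + \<delta> * (norm b)\<^sup>2"
    using d assms by (intro add_right_mono mult_left_mono power_mono) auto
  finally show ?thesis by simp
qed

text \<open>A fixed weight \<delta> would leave an error \<delta>|g|^2. A weight that tends to 0 but
  stays above the distance \<open>d n\<close> makes this error vanish and keeps d^2/\<delta> below
  d.\<close>

lemma L2_norm_power2_tendsto:
  fixes f :: "nat \<Rightarrow> 'a \<Rightarrow> 'b::{second_countable_topology, real_normed_vector}"
  assumes f: "L2_tendsto M f g"
  shows "(\<lambda>n. (L2_norm M (f n))\<^sup>2) \<longlonglongrightarrow> (L2_norm M g)\<^sup>2"
proof -
  define d where "d n = L2_norm M (\<lambda>x. f n x - g x)" for n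
  have d: "d \<longlonglongrightarrow> 0" "\<And>n. 0 \<le> d n" 
    using f by (auto simp: L2_tendsto_def d_def[abs_def] L2_norm_nonneg)
  have int: "integrable M (\<lambda>x. (norm (f n x))\<^sup>2)" "integrable M (\<lambda>x. (norm (g x))\<^sup>2)" 
    "integrable M (\<lambda>x. (norm (f n x - g x))\<^sup>2)" for n
    using L2_space_diff[of "f n" M g] f by (auto simp: L2_tendsto_def L2_space_def)
  \<comment> \<open>The weight \<open>\<delta>\<close> in the pointwise bound must stay positive even when \<open>d n = 0\<close>.\<close>
  define e where "e n = d n + 1 / real (Suc n)" for n
  have e: "0 < e n" "d n \<le> e n" for n using d(2)[of n] by (auto simp: e_def add_nonneg_pos)
  have e0: "e \<longlonglongrightarrow> 0"
    unfolding e_def[abs_def] using tendsto_add[OF d(1) LIMSEQ_inverse_real_of_nat]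
    by (simp add: inverse_eq_divide)
  have bound: "\<bar>(L2_norm M (f n))\<^sup>2 - (L2_norm M g)\<^sup>2\<bar> \<le> (d n)\<^sup>2 + d n + e n * (L2_norm M g)\<^sup>2" for n
  proof -
    have "\<bar>(L2_norm M (f n))\<^sup>2 - (L2_norm M g)\<^sup>2\<bar> = \<bar>\<integral>x. (norm (f n x))\<^sup>2 - (norm (g x))\<^sup>2 \<partial>M\<bar>"
      unfolding L2_norm_power2 using int by simp
    also have "\<dots> \<le> (\<integral>x. (1 + 1 / e n) * (norm (f n x - g x))\<^sup>2 + e n * (norm (g x))\<^sup>2 \<partial>M)"
      using int by (intro integral_abs_bound[THEN order_trans] integral_mono norm_power2_diff_le e) auto
    also have "\<dots> = (1 + 1 / e n) * (d n)\<^sup>2 + e n * (L2_norm M g)\<^sup>2"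
      unfolding L2_norm_power2 d_def using int by simp
    also have "(1 + 1 / e n) * (d n)\<^sup>2 = (d n)\<^sup>2 + d n * (d n / e n)"
      by (simp add: algebra_simps power2_eq_square)
    also have "d n * (d n / e n) \<le> d n * 1"
      using e[of n] d(2)[of n] by (intro mult_left_mono) auto
    finally show ?thesis by simp
  qed
  have "(\<lambda>n. (d n)\<^sup>2 + d n + e n * (L2_norm M g)\<^sup>2) \<longlonglongrightarrow> 0"
    using d(1) e0 by (auto intro!: tendsto_eq_intros)
  then have "(\<lambda>n. (L2_norm M (f n))\<^sup>2 - (L2_norm M g)\<^sup>2) \<longlonglongrightarrow> 0"
    by (rule Lim_null_comparison[rotated]) (use bound in auto)
  then show ?thesis by (simp add: LIM_zero_iff)
qed

text \<open>This is nonnegativity of the variance of |X|.\<close>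

lemma (in prob_space) expectation_abs_le_L2_norm:
  assumes "X \<in> L2_space M"
  shows "expectation (\<lambda>\<omega>. \<bar>X \<omega>\<bar>) \<le> L2_norm M X"
proof -
  have [measurable]: "X \<in> borel_measurable M" and i: "integrable M (\<lambda>x. (X x)\<^sup>2)"
    using assms by (auto simp: L2_space_def)
  have "integrable M X" by (rule square_integrable_imp_integrable) (use i in auto)
  then have "(expectation (\<lambda>\<omega>. \<bar>X \<omega>\<bar>))\<^sup>2 \<le> expectation (\<lambda>\<omega>. (X \<omega>)\<^sup>2)"
    using variance_eq[of "\<lambda>\<omega>. \<bar>X \<omega>\<bar>"] variance_positive[of "\<lambda>\<omega>. \<bar>X \<omega>\<bar>"] i by simp
  then show ?thesis unfolding L2_norm_def by (simp add: real_le_rsqrt)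
qed

text \<open>The map x \<mapsto> exp(ix) is 1-Lipschitz, and on a probability space the mean absolute
  difference is at most the L2 distance.\<close>

lemma (in prob_space) L2_tendsto_iexp:
  fixes X :: "'a \<Rightarrow> real"
  assumes "L2_tendsto M Y X"
  shows "(\<lambda>n. CLINT \<omega>|M. iexp (Y n \<omega>)) \<longlonglongrightarrow> (CLINT \<omega>|M. iexp (X \<omega>))"
proof -
  have L: "(\<lambda>\<omega>. Y n \<omega> - X \<omega>) \<in> L2_space M" for n
    using assms by (auto simp: L2_tendsto_def intro!: L2_space_diff)
  have [measurable]: "X \<in> borel_measurable M" "Y n \<in> borel_measurable M" for n
    using assms by (auto simp: L2_tendsto_def L2_space_def)
  have bound: "norm ((CLINT \<omega>|M. iexp (Y n \<omega>)) - (CLINT \<omega>|M. iexp (X \<omega>))) \<le> L2_norm M (\<lambda>\<omega>. Y n \<omega> - X \<omega>)" for n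
  proof -
    have i: "integrable M (\<lambda>\<omega>. iexp (Y n \<omega>))" "integrable M (\<lambda>\<omega>. iexp (X \<omega>))"
      by (auto intro!: integrable_const_bound[of _ 1])
    have pw: "norm (iexp (Y n \<omega>) - iexp (X \<omega>)) \<le> \<bar>Y n \<omega> - X \<omega>\<bar>" for \<omega>
    proof -
      have "iexp (Y n \<omega>) - iexp (X \<omega>) = iexp (X \<omega>) * (iexp (Y n \<omega> - X \<omega>) - 1)"
        by (simp add: algebra_simps flip: exp_add)
      then have "norm (iexp (Y n \<omega>) - iexp (X \<omega>)) = norm (iexp (Y n \<omega> - X \<omega>) - 1)"
        by (simp add: norm_mult)
      also have "\<dots> \<le> \<bar>Y n \<omega> - X \<omega>\<bar>"
        using iexp_approx1[of "Y n \<omega> - X \<omega>" 0] by simp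
      finally show ?thesis .
    qed
    have iL: "integrable M (\<lambda>\<omega>. Y n \<omega> - X \<omega>)"
      by (rule square_integrable_imp_integrable) (use L[of n] in \<open>auto simp: L2_space_def\<close>)
    have "norm ((CLINT \<omega>|M. iexp (Y n \<omega>)) - (CLINT \<omega>|M. iexp (X \<omega>))) = 
      norm (CLINT \<omega>|M. iexp (Y n \<omega>) - iexp (X \<omega>))"
      using i by simp
    also have "\<dots> \<le> (\<integral>\<omega>. \<bar>Y n \<omega> - X \<omega>\<bar> \<partial>M)"
      by (rule order_trans[OF integral_norm_bound integral_mono]) (use i iL pw in auto)
    also have "\<dots> \<le> L2_norm M (\<lambda>\<omega>. Y n \<omega> - X \<omega>)" by (rule expectation_abs_le_L2_norm[OF L])
    finally show ?thesis .
  qed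
  have "(\<lambda>n. (CLINT \<omega>|M. iexp (Y n \<omega>)) - (CLINT \<omega>|M. iexp (X \<omega>))) \<longlonglongrightarrow> 0"
    by (rule Lim_null_comparison[of _ "\<lambda>n. L2_norm M (\<lambda>\<omega>. Y n \<omega> - X \<omega>)"]) (use bound assms in \<open>auto simp: L2_tendsto_def\<close>)
  then show ?thesis by (simp add: LIM_zero_iff)
qed

section \<open>Linear combinations of pairings and their characteristic functions\<close>

lemma space_mittag_leffler_measure: "mittag_leffler_measure \<beta> \<mu> \<Longrightarrow> space \<mu> = tempered"
  using sets_eq_imp_space_eq[of \<mu> cylinder_algebra]
  by (simp add: mittag_leffler_measure_def cylinder_algebra_def space_measure_of_conv)

lemma dual_pairing_add:
  assumes \<mu>: "mittag_leffler_measure \<beta> \<mu>"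
    and X: "dual_pairing \<mu> \<eta> X" and Y: "dual_pairing \<mu> \<zeta> Y"
  shows "dual_pairing \<mu> (\<lambda>x. \<eta> x + \<zeta> x) (\<lambda>\<omega>. X \<omega> + Y \<omega>)"
proof -
  obtain \<phi> where \<phi>: "\<And>n. \<phi> n \<in> schwartz_vec" "L2_tendsto lborel \<phi> \<eta>" "L2_tendsto \<mu> (\<lambda>n \<omega>. \<omega> (\<phi> n)) X"
    using X by (auto simp: dual_pairing_def)
  obtain \<psi> where \<psi>: "\<And>n. \<psi> n \<in> schwartz_vec" "L2_tendsto lborel \<psi> \<zeta>" "L2_tendsto \<mu> (\<lambda>n \<omega>. \<omega> (\<psi> n)) Y"
    using Y by (auto simp: dual_pairing_def)
  have "L2_tendsto \<mu> (\<lambda>n \<omega>. \<omega> (\<lambda>x. \<phi> n x + \<psi> n x)) (\<lambda>\<omega>. X \<omega> + Y \<omega>)"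
    using L2_tendsto_add[OF \<phi>(3) \<psi>(3)]
    by (rule L2_tendsto_cong[THEN iffD1, rotated 2])
       (use \<phi>(1) \<psi>(1) in \<open>auto simp: space_mittag_leffler_measure[OF \<mu>] tempered_def\<close>)
  then show ?thesis
    unfolding dual_pairing_def using \<phi>(1) \<psi>(1) L2_tendsto_add[OF \<phi>(2) \<psi>(2)]
    by (intro exI[of _ "\<lambda>n x. \<phi> n x + \<psi> n x"]) (auto intro: schwartz_vec_add)
qed

lemma dual_pairing_scaleR:
  assumes \<mu>: "mittag_leffler_measure \<beta> \<mu>" and X: "dual_pairing \<mu> \<eta> X"
  shows "dual_pairing \<mu> (\<lambda>x. c *\<^sub>R \<eta> x) (\<lambda>\<omega>. c * X \<omega>)"
proof -
  obtain \<phi> where \<phi>: "\<And>n. \<phi> n \<in> schwartz_vec" "L2_tendsto lborel \<phi> \<eta>" "L2_tendsto \<mu> (\<lambda>n \<omega>. \<omega> (\<phi> n)) X"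
    using X by (auto simp: dual_pairing_def)
  have "L2_tendsto \<mu> (\<lambda>n \<omega>. \<omega> (\<lambda>x. c *\<^sub>R \<phi> n x)) (\<lambda>\<omega>. c * X \<omega>)"
    using L2_tendsto_scaleR[OF \<phi>(3), of c]
    by (rule L2_tendsto_cong[THEN iffD1, rotated 2])
       (use \<phi>(1) in \<open>auto simp: space_mittag_leffler_measure[OF \<mu>] tempered_def\<close>)
  then show ?thesis
    unfolding dual_pairing_def using \<phi>(1) L2_tendsto_scaleR[OF \<phi>(2), of c]
    by (intro exI[of _ "\<lambda>n x. c *\<^sub>R \<phi> n x"]) (auto intro: schwartz_vec_scaleR)
qed

lemma dual_pairing_zero:
  assumes \<mu>: "mittag_leffler_measure \<beta> \<mu>"
  shows "dual_pairing \<mu> (\<lambda>x. 0) (\<lambda>\<omega>. 0)"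
proof -
  have "\<omega> (\<lambda>x. 0) = 0" if "\<omega> \<in> tempered" for \<omega> :: "'a functional"
  proof -
    \<comment> \<open>Homogeneity with the scalar 0 yields the value at the zero function.\<close>
    have "\<forall>\<phi>\<in>schwartz_vec. \<omega> (\<lambda>x. 0 *\<^sub>R \<phi> x) = 0 * \<omega> \<phi>"
      using that unfolding tempered_def by blast
    from bspec[OF this schwartz_vec_zero] show ?thesis by simp
  qed
  then have "L2_tendsto \<mu> (\<lambda>n \<omega>. \<omega> (\<lambda>x. 0)) (\<lambda>\<omega>. 0) \<longleftrightarrow> L2_tendsto \<mu> (\<lambda>n \<omega>. 0 :: real) (\<lambda>\<omega>. 0)"
    by (intro L2_tendsto_cong) (auto simp: space_mittag_leffler_measure[OF \<mu>])
  then show ?thesis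
    unfolding dual_pairing_def 
    by (intro exI[of _ "\<lambda>n x. 0"]) (auto simp: schwartz_vec_zero L2_tendsto_iff L2_space_def)
qed

lemma dual_pairing_sum:
  assumes \<mu>: "mittag_leffler_measure \<beta> \<mu>" and "finite S"
    and "\<And>k. k \<in> S \<Longrightarrow> dual_pairing \<mu> (\<eta> k) (X k)"
  shows "dual_pairing \<mu> (\<lambda>x. \<Sum>k\<in>S. a k *\<^sub>R \<eta> k x) (\<lambda>\<omega>. \<Sum>k\<in>S. a k * X k \<omega>)"
  using assms(2,3)
proof (induction S rule: finite_induct)
  case (insert k S)
  then show ?case
    using dual_pairing_add[OF \<mu> dual_pairing_scaleR[OF \<mu>, of "\<eta> k" "X k" "a k"], of "\<lambda>x. \<Sum>k\<in>S. a k *\<^sub>R \<eta> k x" "\<lambda>\<omega>. \<Sum>k\<in>S. a k * X k \<omega>"]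
    by simp
qed (simp add: dual_pairing_zero[OF \<mu>])

lemma dual_pairing_L2_space: "dual_pairing \<mu> \<eta> X \<Longrightarrow> X \<in> L2_space \<mu>"
  by (auto simp: dual_pairing_def L2_tendsto_def)

lemma dual_pairing_borel_measurable: "dual_pairing \<mu> \<eta> X \<Longrightarrow> X \<in> borel_measurable \<mu>"
  using dual_pairing_L2_space by (auto simp: L2_space_def)

text \<open>Frequency 1 suffices: any other frequency is absorbed into \<eta> by linearity of the
  pairing.\<close>

lemma dual_pairing_iexp:
  assumes \<mu>: "mittag_leffler_measure \<beta> \<mu>" and \<beta>: "0 < \<beta>" and X: "dual_pairing \<mu> \<eta> X"
  shows "(CLINT \<omega>|\<mu>. iexp (X \<omega>)) = of_real (mittag_leffler_real \<beta> (- (\<integral>x. (norm (\<eta> x))\<^sup>2 \<partial>lborel) / 2))"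
proof -
  interpret prob_space \<mu> using \<mu> by (simp add: mittag_leffler_measure_def)
  obtain \<phi> where \<phi>: "\<And>n. \<phi> n \<in> schwartz_vec" "L2_tendsto lborel \<phi> \<eta>" "L2_tendsto \<mu> (\<lambda>n \<omega>. \<omega> (\<phi> n)) X"
    using X by (auto simp: dual_pairing_def)
  have "(CLINT \<omega>|\<mu>. iexp (\<omega> (\<phi> n))) = mittag_leffler \<beta> (of_real (- (L2_norm lborel (\<phi> n))\<^sup>2 / 2))" for n
    using \<mu> \<phi>(1) by (simp add: mittag_leffler_measure_def)
  then have eq: "(CLINT \<omega>|\<mu>. iexp (\<omega> (\<phi> n))) = of_real (mittag_leffler_real \<beta> (- (L2_norm lborel (\<phi> n))\<^sup>2 / 2))" for n
    by (simp only: mittag_leffler_of_real[OF \<beta>])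
  have "(\<lambda>n. - (L2_norm lborel (\<phi> n))\<^sup>2 / 2) \<longlonglongrightarrow> - (L2_norm lborel \<eta>)\<^sup>2 / 2"
    using L2_norm_power2_tendsto[OF \<phi>(2)] by (auto intro!: tendsto_intros)
  then have "(\<lambda>n. CLINT \<omega>|\<mu>. iexp (\<omega> (\<phi> n))) \<longlonglongrightarrow> of_real (mittag_leffler_real \<beta> (- (L2_norm lborel \<eta>)\<^sup>2 / 2))"
    unfolding eq by (intro tendsto_of_real isCont_tendsto_compose[OF isCont_mittag_leffler_real[OF \<beta>]])
  from LIMSEQ_unique[OF L2_tendsto_iexp[OF \<phi>(3)] this] show ?thesis
    by (simp add: L2_norm_power2)
qed

section \<open>Independence from characteristic functions\<close>

text \<open>After normalisation the weight \<open>W\<close> defines a new probability measure, and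
  \<open>P\<close> is the law of \<open>Y\<close> under it. Integrals of exp(ibY) against the weight
  thereby become a genuine characteristic function.\<close>

lemma (in prob_space) weighted_law:
  assumes [measurable]: "W \<in> borel_measurable M" "Y \<in> borel_measurable M"
    and W: "\<And>\<omega>. 0 \<le> W \<omega>" "integrable M W" and c: "0 < expectation W"
  defines "P \<equiv> distr (density M (\<lambda>\<omega>. ennreal (W \<omega> / expectation W))) borel Y"
  shows "real_distribution P"
    and "char P b = (CLINT \<omega>|M. W \<omega> * iexp (b * Y \<omega>)) / complex_of_real (expectation W)"
    and "A \<in> sets borel \<Longrightarrow> expectation (\<lambda>\<omega>. W \<omega> * indicator A (Y \<omega>)) = expectation W * measure P A"
proof -
  let ?c = "expectation W"
  let ?D = "density M (\<lambda>\<omega>. ennreal (W \<omega> / ?c))"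
  have D: "prob_space ?D"
  proof
    have "emeasure ?D (space ?D) = (\<integral>\<^sup>+\<omega>. ennreal (W \<omega> / ?c) \<partial>M)"
      by (subst emeasure_density) (auto intro!: nn_integral_cong)
    also have "\<dots> = ennreal (\<integral>\<omega>. W \<omega> / ?c \<partial>M)"
      using W c by (intro nn_integral_eq_integral) auto
    also have "\<dots> = 1" using c by simp
    finally show "emeasure ?D (space ?D) = 1" .
  qed
  interpret D: prob_space ?D by (rule D)
  show P: "real_distribution P"
    unfolding P_def by (rule D.real_distribution_distr) simp
  interpret P: real_distribution P by (rule P)
  have int: "(\<integral>x. f x \<partial>P) = (\<integral>\<omega>. (W \<omega> / ?c) *\<^sub>R f (Y \<omega>) \<partial>M)" 
    if [measurable]: "f \<in> borel_measurable borel" for f :: "real \<Rightarrow> 'b::{banach, second_countable_topology}"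
    unfolding P_def using W c
    by (subst integral_distr) (auto simp: integral_density)
  have "char P b = (CLINT \<omega>|M. (W \<omega> / ?c) *\<^sub>R iexp (b * Y \<omega>))"
    unfolding char_def by (rule int) simp
  also have "\<dots> = (CLINT \<omega>|M. W \<omega> * iexp (b * Y \<omega>) / ?c)"
    by (intro Bochner_Integration.integral_cong) (simp_all add: scaleR_conv_of_real)
  also have "\<dots> = (CLINT \<omega>|M. W \<omega> * iexp (b * Y \<omega>)) / ?c" by simp
  finally show "char P b = (CLINT \<omega>|M. W \<omega> * iexp (b * Y \<omega>)) / ?c" by simp
  show "expectation (\<lambda>\<omega>. W \<omega> * indicator A (Y \<omega>)) = ?c * measure P A" if [measurable]: "A \<in> sets borel"
  proof -
    have "measure P A = (\<integral>x. indicator A x \<partial>P)"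
      using that by (simp add: P_def)
    also have "\<dots> = (\<integral>\<omega>. (W \<omega> / ?c) *\<^sub>R indicator A (Y \<omega>) \<partial>M)" by (rule int) simp
    also have "\<dots> = expectation (\<lambda>\<omega>. W \<omega> * indicator A (Y \<omega>)) / ?c" by simp
    finally show ?thesis using c by simp
  qed
qed

text \<open>Frequency b = 0 shows that the total weights agree. If they vanish, both sides are 0;
  otherwise both weights can be normalised and one-dimensional uniqueness applies.\<close>

lemma weighted_Levy_uniqueness:
  fixes W Y :: "'a \<Rightarrow> real" and W' Y' :: "'b \<Rightarrow> real"
  assumes "prob_space M" "prob_space N"
    and [measurable]: "W \<in> borel_measurable M" "Y \<in> borel_measurable M"
      "W' \<in> borel_measurable N" "Y' \<in> borel_measurable N"
    and W: "\<And>\<omega>. 0 \<le> W \<omega>" "\<And>\<omega>. 0 \<le> W' \<omega>" "integrable M W" "integrable N W'"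
    and char: "\<And>b. (CLINT \<omega>|M. W \<omega> * iexp (b * Y \<omega>)) = (CLINT \<omega>|N. W' \<omega> * iexp (b * Y' \<omega>))"
    and A[measurable]: "A \<in> sets borel"
  shows "(\<integral>\<omega>. W \<omega> * indicator A (Y \<omega>) \<partial>M) = (\<integral>\<omega>. W' \<omega> * indicator A (Y' \<omega>) \<partial>N)"
proof -
  interpret M: prob_space M by fact
  interpret N: prob_space N by fact
  have "(CLINT \<omega>|M. W \<omega>) = (CLINT \<omega>|N. W' \<omega>)" using char[of 0] by simp
  then have eq: "(\<integral>\<omega>. W \<omega> \<partial>M) = (\<integral>\<omega>. W' \<omega> \<partial>N)" by simp
  show ?thesis
  proof (cases "(\<integral>\<omega>. W \<omega> \<partial>M) = 0")
    case True
    then have "AE \<omega> in M. W \<omega> = 0" "AE \<omega> in N. W' \<omega> = 0"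
      using eq W integral_nonneg_eq_0_iff_AE[of M W] integral_nonneg_eq_0_iff_AE[of N W'] by auto
    then have "(\<integral>\<omega>. W \<omega> * indicator A (Y \<omega>) \<partial>M) = 0" "(\<integral>\<omega>. W' \<omega> * indicator A (Y' \<omega>) \<partial>N) = 0"
      by (auto intro!: integral_eq_zero_AE)
    then show ?thesis by simp
  next
    case False
    moreover have "0 \<le> (\<integral>\<omega>. W \<omega> \<partial>M)" using W by (intro Bochner_Integration.integral_nonneg) auto
    ultimately have c: "0 < (\<integral>\<omega>. W \<omega> \<partial>M)" "0 < (\<integral>\<omega>. W' \<omega> \<partial>N)" using eq by auto
    note m = M.weighted_law[of W Y, OF _ _ W(1) W(3) c(1)]
    note n = N.weighted_law[of W' Y', OF _ _ W(2) W(4) c(2)]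
    have "distr (density M (\<lambda>\<omega>. ennreal (W \<omega> / M.expectation W))) borel Y = 
          distr (density N (\<lambda>\<omega>. ennreal (W' \<omega> / N.expectation W'))) borel Y'"
      by (rule Levy_uniqueness[OF m(1)[OF assms(3,4)] n(1)[OF assms(5,6)]], rule ext)
         (simp only: m(2)[OF assms(3,4)] n(2)[OF assms(5,6)] char, simp only: eq)
    then show ?thesis using m(3)[OF assms(3,4) A] n(3)[OF assms(5,6) A] eq by simp
  qed
qed

lemma iexp_add: "iexp (x + y) = iexp x * iexp y"
  by (simp add: distrib_left exp_add)

text \<open>The signed weights \<open>V cos S\<close> and \<open>V sin S\<close> are reduced to the nonnegative weights
  \<open>V (1 + cos S)\<close> and \<open>V (1 + sin S)\<close>.\<close>

lemma iexp_to_indicator: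
  fixes V S Y :: "'a \<Rightarrow> real" and V' S' Y' :: "'b \<Rightarrow> real"
  assumes "prob_space M" "prob_space N"
    and [measurable]: "V \<in> borel_measurable M" "S \<in> borel_measurable M" "Y \<in> borel_measurable M"
      "V' \<in> borel_measurable N" "S' \<in> borel_measurable N" "Y' \<in> borel_measurable N"
    and V: "\<And>\<omega>. V \<omega> \<in> {0..1}" "\<And>\<omega>. V' \<omega> \<in> {0..1}"
    and char: "\<And>a b. (CLINT \<omega>|M. V \<omega> * iexp (a * S \<omega> + b * Y \<omega>)) = (CLINT \<omega>|N. V' \<omega> * iexp (a * S' \<omega> + b * Y' \<omega>))"
    and A[measurable]: "A \<in> sets borel"
  shows "(CLINT \<omega>|M. V \<omega> * indicator A (Y \<omega>) * iexp (S \<omega>)) = (CLINT \<omega>|N. V' \<omega> * indicator A (Y' \<omega>) * iexp (S' \<omega>))"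
proof -
  interpret M: prob_space M by fact
  interpret N: prob_space N by fact
  have iM: "integrable M (\<lambda>\<omega>. complex_of_real (V \<omega>) * iexp (a * S \<omega> + b * Y \<omega>))" for a b
    using V by (intro M.integrable_const_bound[of _ 1]) (auto simp: norm_mult)
  have iN: "integrable N (\<lambda>\<omega>. complex_of_real (V' \<omega>) * iexp (a * S' \<omega> + b * Y' \<omega>))" for a b
    using V by (intro N.integrable_const_bound[of _ 1]) (auto simp: norm_mult)
  \<comment> \<open>Here \<open>g\<close> stands for 0, cos or sin, each a combination of exp(ix)
    and exp(-ix). Since |g| \<le> 1, the weight built from 1 + g is nonnegative, and its transform
    combines the given ones at the frequencies 0, 1 and -1 in \<open>S\<close>.\<close>
  have weight: "(\<integral>\<omega>. (V \<omega> * (1 + g (S \<omega>))) * indicator A (Y \<omega>) \<partial>M) = (\<integral>\<omega>. (V' \<omega> * (1 + g (S' \<omega>))) * indicator A (Y' \<omega>) \<partial>N)"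
    if g: "\<And>x. complex_of_real (g x) = u * iexp x + v * iexp (- x)" "\<And>x. g x \<in> {-1..1}" 
      "g \<in> borel_measurable borel" for g :: "real \<Rightarrow> real" and u v
  proof (rule weighted_Levy_uniqueness)
    note [measurable] = g(3)
    have e: "complex_of_real (r * (1 + g s)) * iexp (b * y) = of_real r * iexp (0 * s + b * y) +
        u * (of_real r * iexp (1 * s + b * y)) + v * (of_real r * iexp ((- 1) * s + b * y))" for r s b y
      by (simp add: g(1) iexp_add distrib_left distrib_right exp_add exp_diff exp_minus field_simps)
    show "(CLINT \<omega>|M. complex_of_real (V \<omega> * (1 + g (S \<omega>))) * iexp (b * Y \<omega>)) =
      (CLINT \<omega>|N. complex_of_real (V' \<omega> * (1 + g (S' \<omega>))) * iexp (b * Y' \<omega>))" for b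
      unfolding e using iM iN
      by (simp only: Bochner_Integration.integral_add Bochner_Integration.integrable_add 
          integrable_mult_right integral_mult_right_zero char)
    have b: "0 \<le> r * (1 + g x) \<and> r * (1 + g x) \<le> 2" if "r \<in> {0..1}" for r x
      using g(2)[of x] that mult_mono[of r 1 "1 + g x" 2] by auto
    show "0 \<le> V \<omega> * (1 + g (S \<omega>))" for \<omega> using b[OF V(1)] by blast
    show "0 \<le> V' \<omega> * (1 + g (S' \<omega>))" for \<omega> using b[OF V(2)] by blast
    show "integrable M (\<lambda>\<omega>. V \<omega> * (1 + g (S \<omega>)))"
      by (rule M.integrable_const_bound[of _ 2]) (use b[OF V(1)] in auto)
    show "integrable N (\<lambda>\<omega>. V' \<omega> * (1 + g (S' \<omega>)))"
      by (rule N.integrable_const_bound[of _ 2]) (use b[OF V(2)] in auto)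
  qed (use assms(1,2) g(3) in auto)
  have bM: "integrable M (\<lambda>\<omega>. V \<omega> * g (S \<omega>) * indicator A (Y \<omega>))"
    if "\<And>x. g x \<in> {-1..1}" "g \<in> borel_measurable borel" for g :: "real \<Rightarrow> real" 
  proof (rule M.integrable_const_bound[of _ 1])
    note [measurable] = that(2)
    show "AE x in M. norm (V x * g (S x) * indicat_real A (Y x)) \<le> 1"
      using V(1) that(1) by (auto simp: abs_mult indicator_def abs_le_iff intro!: AE_I2 mult_le_one)
    show "(\<lambda>\<omega>. V \<omega> * g (S \<omega>) * indicat_real A (Y \<omega>)) \<in> borel_measurable M" by measurable
  qed
  have bN: "integrable N (\<lambda>\<omega>. V' \<omega> * g (S' \<omega>) * indicator A (Y' \<omega>))"
    if "\<And>x. g x \<in> {-1..1}" "g \<in> borel_measurable borel" for g :: "real \<Rightarrow> real" 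
  proof (rule N.integrable_const_bound[of _ 1])
    note [measurable] = that(2)
    show "AE x in N. norm (V' x * g (S' x) * indicat_real A (Y' x)) \<le> 1"
      using V(2) that(1) by (auto simp: abs_mult indicator_def abs_le_iff intro!: AE_I2 mult_le_one)
    show "(\<lambda>\<omega>. V' \<omega> * g (S' \<omega>) * indicat_real A (Y' \<omega>)) \<in> borel_measurable N" by measurable
  qed
  have one: "(\<integral>\<omega>. V \<omega> * 1 * indicator A (Y \<omega>) \<partial>M) = (\<integral>\<omega>. V' \<omega> * 1 * indicator A (Y' \<omega>) \<partial>N)"
    using weight[of "\<lambda>_. 0" 0 0] by simp
  have trig: "(\<integral>\<omega>. V \<omega> * g (S \<omega>) * indicator A (Y \<omega>) \<partial>M) = (\<integral>\<omega>. V' \<omega> * g (S' \<omega>) * indicator A (Y' \<omega>) \<partial>N)"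
    if g: "\<And>x. complex_of_real (g x) = u * iexp x + v * iexp (- x)" "\<And>x. g x \<in> {-1..1}" 
      "g \<in> borel_measurable borel" for g :: "real \<Rightarrow> real" and u v
  proof -
    \<comment> \<open>Subtracting the identity for the weight \<open>V\<close> itself leaves the one
      for the signed weight.\<close>
    have d: "r * (1 + g x) * i = r * 1 * i + r * g x * i" for r x i :: real by (simp add: algebra_simps)
    show ?thesis
      using weight[OF g] one bM[of "\<lambda>_. 1"] bN[of "\<lambda>_. 1"] bM[OF g(2,3)] bN[OF g(2,3)] unfolding d
      by (simp add: Bochner_Integration.integral_add)
  qed
  have c: "(\<integral>\<omega>. V \<omega> * cos (S \<omega>) * indicator A (Y \<omega>) \<partial>M) = (\<integral>\<omega>. V' \<omega> * cos (S' \<omega>) * indicator A (Y' \<omega>) \<partial>N)"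
    by (rule trig[of cos "1/2" "1/2"]) (auto simp: cos_of_real[symmetric] cos_exp_eq field_simps)
  have s: "(\<integral>\<omega>. V \<omega> * sin (S \<omega>) * indicator A (Y \<omega>) \<partial>M) = (\<integral>\<omega>. V' \<omega> * sin (S' \<omega>) * indicator A (Y' \<omega>) \<partial>N)"
    by (rule trig[of sin "1/(2*\<i>)" "-1/(2*\<i>)"]) (auto simp: sin_of_real[symmetric] sin_exp_eq field_simps)
  have e: "complex_of_real (r * indicator A y) * iexp x = of_real (r * cos x * indicator A y) + \<i> * of_real (r * sin x * indicator A y)" for r x y
    by (simp add: exp_Euler indicator_def algebra_simps cos_of_real sin_of_real)
  show ?thesis
    unfolding e using bM[of cos] bM[of sin] bN[of cos] bN[of sin] c s
    by (auto simp del: of_real_mult simp: Bochner_Integration.integral_add)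
qed

text \<open>Induction on the set \<open>K\<close> of coordinates whose exponential has been replaced
  by an indicator. The coefficients \<open>a\<close> are kept general, since each step needs a whole
  family of frequencies. For K = J no exponential is left.\<close>

lemma char_determines_cylinder_probabilities:
  fixes Z :: "'k \<Rightarrow> 'a \<Rightarrow> real" and Z' :: "'k \<Rightarrow> 'b \<Rightarrow> real"
  assumes M: "prob_space M" and N: "prob_space N" and J: "finite J"
    and meas: "\<And>k. k \<in> J \<Longrightarrow> Z k \<in> borel_measurable M" "\<And>k. k \<in> J \<Longrightarrow> Z' k \<in> borel_measurable N"
    and char: "\<And>a. (CLINT \<omega>|M. iexp (\<Sum>k\<in>J. a k * Z k \<omega>)) = (CLINT \<omega>|N. iexp (\<Sum>k\<in>J. a k * Z' k \<omega>))"
    and A: "\<And>k. k \<in> J \<Longrightarrow> A k \<in> sets borel"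
  shows "measure M {\<omega>\<in>space M. \<forall>k\<in>J. Z k \<omega> \<in> A k} = measure N {\<omega>\<in>space N. \<forall>k\<in>J. Z' k \<omega> \<in> A k}"
proof -
  have "(CLINT \<omega>|M. of_real (\<Prod>k\<in>K. indicator (A k) (Z k \<omega>)) * iexp (\<Sum>k\<in>J-K. a k * Z k \<omega>))
      = (CLINT \<omega>|N. of_real (\<Prod>k\<in>K. indicator (A k) (Z' k \<omega>)) * iexp (\<Sum>k\<in>J-K. a k * Z' k \<omega>))"
    if "K \<subseteq> J" for K a
    using finite_subset[OF that J] that
  proof (induction K arbitrary: a rule: finite_induct)
    case empty
    then show ?case using char by simp
  next
    case (insert j K)
    then have j: "j \<in> J" "j \<notin> K" "K \<subseteq> J" by auto
    have [measurable]: "Z k \<in> borel_measurable M" "Z' k \<in> borel_measurable N" "A k \<in> sets borel" if "k \<in> J" for k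
      using meas A that by auto
    have fin: "finite (J - K)" "j \<in> J - K" using J j by auto
    have dif: "J - insert j K = J - K - {j}" by auto
    \<comment> \<open>With coefficient \<open>q\<close> at \<open>j\<close> and
      \<open>p * a k\<close> elsewhere, the induction hypothesis supplies the joint transform of
      \<open>Z j\<close> and of the remaining combination at all frequencies (p, q).\<close>
    have sum: "(\<Sum>k\<in>J-K. (if k = j then q else p * a k) * z k) = p * (\<Sum>k\<in>J-insert j K. a k * z k) + q * z j" for p q and z :: "'k \<Rightarrow> real"
    proof -
      have "(\<Sum>k\<in>J-K. (if k = j then q else p * a k) * z k) = q * z j + (\<Sum>k\<in>J-K-{j}. (if k = j then q else p * a k) * z k)"
        using fin by (subst sum.remove[of _ j]) auto
      also have "(\<Sum>k\<in>J-K-{j}. (if k = j then q else p * a k) * z k) = (\<Sum>k\<in>J-K-{j}. p * (a k * z k))"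
        by (intro sum.cong) auto
      finally show ?thesis unfolding dif by (simp add: sum_distrib_left)
    qed
    have "(CLINT \<omega>|M. of_real ((\<Prod>k\<in>K. indicator (A k) (Z k \<omega>)) * indicator (A j) (Z j \<omega>)) * iexp (\<Sum>k\<in>J-insert j K. a k * Z k \<omega>))
      = (CLINT \<omega>|N. of_real ((\<Prod>k\<in>K. indicator (A k) (Z' k \<omega>)) * indicator (A j) (Z' j \<omega>)) * iexp (\<Sum>k\<in>J-insert j K. a k * Z' k \<omega>))"
    proof (rule iexp_to_indicator[OF M N])
      show "(CLINT \<omega>|M. of_real (\<Prod>k\<in>K. indicator (A k) (Z k \<omega>)) * iexp (p * (\<Sum>k\<in>J-insert j K. a k * Z k \<omega>) + q * Z j \<omega>))
        = (CLINT \<omega>|N. of_real (\<Prod>k\<in>K. indicator (A k) (Z' k \<omega>)) * iexp (p * (\<Sum>k\<in>J-insert j K. a k * Z' k \<omega>) + q * Z' j \<omega>))" for p q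
        using insert.IH[OF j(3), of "\<lambda>k. if k = j then q else p * a k"] unfolding sum .
      show "(\<Prod>k\<in>K. indicator (A k) (Z k \<omega>)) \<in> {0..1::real}" "(\<Prod>k\<in>K. indicator (A k) (Z' k \<omega>')) \<in> {0..1::real}" for \<omega> \<omega>'
        by (auto intro!: prod_nonneg prod_le_1)
      have "(\<lambda>\<omega>. indicat_real (A k) (Z k \<omega>)) \<in> borel_measurable M" if "k \<in> K" for k
      proof -
        have [simp]: "k \<in> J" using that j by auto
        show ?thesis by measurable
      qed
      then show "(\<lambda>\<omega>. \<Prod>k\<in>K. indicat_real (A k) (Z k \<omega>)) \<in> borel_measurable M"
        by (intro borel_measurable_prod)
      have "(\<lambda>\<omega>. indicat_real (A k) (Z' k \<omega>)) \<in> borel_measurable N" if "k \<in> K" for k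
      proof -
        have [simp]: "k \<in> J" using that j by auto
        show ?thesis by measurable
      qed
      then show "(\<lambda>\<omega>. \<Prod>k\<in>K. indicat_real (A k) (Z' k \<omega>)) \<in> borel_measurable N"
        by (intro borel_measurable_prod)
    qed (use j in auto)
    then show ?case using insert.hyps by (simp add: mult_ac)
  qed
  from this[of J] have "(CLINT \<omega>|M. of_real (\<Prod>k\<in>J. indicator (A k) (Z k \<omega>))) = (CLINT \<omega>|N. of_real (\<Prod>k\<in>J. indicator (A k) (Z' k \<omega>)))"
    by simp
  then have eq: "(\<integral>\<omega>. (\<Prod>k\<in>J. indicator (A k) (Z k \<omega>)) \<partial>M) = (\<integral>\<omega>. (\<Prod>k\<in>J. indicat_real (A k) (Z' k \<omega>)) \<partial>N)"
    by (simp only: integral_complex_of_real of_real_eq_iff)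
  have ind: "(\<integral>\<omega>. (\<Prod>k\<in>J. indicat_real (A k) (X k \<omega>)) \<partial>L) = measure L {\<omega>\<in>space L. \<forall>k\<in>J. X k \<omega> \<in> A k}" 
    if "\<And>k. k \<in> J \<Longrightarrow> X k \<in> borel_measurable L" "prob_space L" for X :: "'k \<Rightarrow> 'c \<Rightarrow> real" and L
  proof -
    interpret prob_space L by fact
    have "(\<integral>\<omega>. (\<Prod>k\<in>J. indicat_real (A k) (X k \<omega>)) \<partial>L) = (\<integral>\<omega>. indicator {\<omega>\<in>space L. \<forall>k\<in>J. X k \<omega> \<in> A k} \<omega> \<partial>L)"
      using J by (intro Bochner_Integration.integral_cong) (auto simp: indicator_def)
    also have "\<dots> = measure L ({\<omega>\<in>space L. \<forall>k\<in>J. X k \<omega> \<in> A k} \<inter> space L)"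
      by simp
    finally show ?thesis by (simp add: Int_absorb2)
  qed
  show ?thesis using eq ind[of Z M] ind[of Z' N] meas M N by simp
qed

lemma (in prob_space) integrable_iexp:
  assumes [measurable]: "X \<in> borel_measurable M"
  shows "integrable M (\<lambda>\<omega>. iexp (X \<omega>))"
  by (intro integrable_const_bound[of _ 1]) auto

text \<open>The given variables are compared with independent copies living on the product of copies
  of \<open>M\<close>, one for each index in \<open>I\<close>.\<close>

lemma (in prob_space) indep_vars_paths_of_char:
  fixes Z :: "'i \<Rightarrow> 't \<Rightarrow> 'a \<Rightarrow> real"
  assumes I: "finite I" "I \<noteq> {}"
    and meas: "\<And>i t. i \<in> I \<Longrightarrow> t \<in> T \<Longrightarrow> Z i t \<in> borel_measurable M"
    and char: "\<And>S a. finite S \<Longrightarrow> S \<subseteq> T \<Longrightarrow>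
      (CLINT \<omega>|M. iexp (\<Sum>i\<in>I. \<Sum>t\<in>S. a i t * Z i t \<omega>)) = (\<Prod>i\<in>I. CLINT \<omega>|M. iexp (\<Sum>t\<in>S. a i t * Z i t \<omega>))"
  shows "indep_vars (\<lambda>_. Pi\<^sub>M T (\<lambda>_. borel)) (\<lambda>i \<omega>. \<lambda>t\<in>T. Z i t \<omega>) I"
proof -
  define X where "X i \<omega> = (\<lambda>t\<in>T. Z i t \<omega>)" for i \<omega>
  define \<Omega>' where "\<Omega>' = space (Pi\<^sub>M T (\<lambda>_. borel :: real measure))"
  define G where "G = prod_algebra T (\<lambda>_. borel :: real measure)"
  \<comment> \<open>Preimages of cylinder sets form an intersection-stable generator of the
    \<sigma>-algebra of the i-th path, so independence has to be checked for finitely many times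
    only.\<close>
  define F where "F i = {X i -` B \<inter> space M | B. B \<in> G}" for i
  have X[measurable]: "X i \<in> measurable M (Pi\<^sub>M T (\<lambda>_. borel))" if "i \<in> I" for i
    unfolding X_def[abs_def] using meas[OF that] by (intro measurable_restrict) auto
  have Fev: "F i \<subseteq> events" if "i \<in> I" for i
    using measurable_sets[OF X[OF that]] unfolding F_def G_def sets_PiM by (auto intro: sigma_sets.Basic)
  have cyl: "\<exists>S E. finite S \<and> S \<subseteq> T \<and> (\<forall>t. E t \<in> sets borel) \<and> A = {\<omega>\<in>space M. \<forall>t\<in>S. Z i t \<omega> \<in> E t} \<and> (\<forall>t. t \<notin> S \<longrightarrow> E t = UNIV)"
    if "A \<in> F i" for A i
  proof -
    from that obtain B where B: "A = X i -` B \<inter> space M" "B \<in> prod_algebra T (\<lambda>_. borel :: real measure)"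
      unfolding F_def G_def by auto
    from prod_algebraE[OF B(2)] obtain S E where E: "B = prod_emb T (\<lambda>_. borel) S (\<Pi>\<^sub>E j\<in>S. E j)"
      "finite S" "S \<subseteq> T" "\<And>t. t \<in> S \<Longrightarrow> E t \<in> sets (borel :: real measure)" by metis
    have "A = {\<omega>\<in>space M. \<forall>t\<in>S. Z i t \<omega> \<in> E t}"
      using E(3) by (auto simp: B(1) E(1) prod_emb_def X_def PiE_iff restrict_def extensional_def subset_eq)
    with E show ?thesis
      \<comment> \<open>Setting \<open>E t\<close> to \<open>UNIV\<close> off \<open>S\<close> lets
        cylinders with different time sets be rewritten over their common union
        \<open>U\<close>.\<close>
      by (intro exI[of _ S] exI[of _ "\<lambda>t. if t \<in> S then E t else UNIV"]) auto
  qed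
  have spF: "space M \<in> F i" if "i \<in> I" for i
  proof -
    have "\<Omega>' \<in> G" unfolding G_def \<Omega>'_def space_PiM by (rule space_in_prod_algebra)
    moreover have "X i -` \<Omega>' \<inter> space M = space M"
      using measurable_space[OF X[OF that]] by (auto simp: \<Omega>'_def)
    ultimately show ?thesis unfolding F_def by (metis (mono_tags, lifting) mem_Collect_eq)
  qed
  have "indep_sets F I"
  proof (subst indep_sets_finite[OF I(2,1) Fev spF])
    show "\<forall>A\<in>Pi I F. prob (\<Inter>j\<in>I. A j) = (\<Prod>j\<in>I. prob (A j))"
    proof
      fix A assume A: "A \<in> Pi I F"
      define Q where "Q i S E \<longleftrightarrow> finite S \<and> S \<subseteq> T \<and> (\<forall>t. E t \<in> sets borel) \<and>
         A i = {\<omega>\<in>space M. \<forall>t\<in>S. Z i t \<omega> \<in> E t} \<and> (\<forall>t. t \<notin> S \<longrightarrow> E t = UNIV)" for i S and E :: "'t \<Rightarrow> real set"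
      have "\<forall>i\<in>I. \<exists>S E. Q i S E"
        unfolding Q_def using cyl A by blast
      then obtain S E where "\<forall>i\<in>I. Q i (S i) (E i)" by metis
      then have SE: "finite (S i)" "S i \<subseteq> T" "\<And>t. E i t \<in> sets borel"
         "A i = {\<omega>\<in>space M. \<forall>t\<in>S i. Z i t \<omega> \<in> E i t}" "\<And>t. t \<notin> S i \<Longrightarrow> E i t = UNIV" if "i \<in> I" for i
        using that unfolding Q_def by blast+
      define U where "U = (\<Union>i\<in>I. S i)"
      have U: "finite U" "U \<subseteq> T" using SE I by (auto simp: U_def)
      have AU: "A i = {\<omega>\<in>space M. \<forall>t\<in>U. Z i t \<omega> \<in> E i t}" if "i \<in> I" for i
      proof -
        have "E i t = UNIV" if "t \<notin> S i" for t using SE(5)[OF \<open>i \<in> I\<close> that] .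
        moreover have "S i \<subseteq> U" using that by (auto simp: U_def)
        ultimately show ?thesis unfolding SE(4)[OF that] by blast
      qed
      interpret P: finite_product_prob_space "\<lambda>_::'i. M" I
        by unfold_locales (fact I(1))
      let ?N = "Pi\<^sub>M I (\<lambda>_. M)"
      have "prob {\<omega>\<in>space M. \<forall>k\<in>I \<times> U. Z (fst k) (snd k) \<omega> \<in> E (fst k) (snd k)} =
        measure ?N {f\<in>space ?N. \<forall>k\<in>I \<times> U. Z (fst k) (snd k) (f (fst k)) \<in> E (fst k) (snd k)}"
      proof (rule char_determines_cylinder_probabilities)
        show "prob_space M" "prob_space ?N" by unfold_locales
        show "finite (I \<times> U)" using I U by auto
        fix k assume k: "k \<in> I \<times> U"
        then have [measurable]: "Z (fst k) (snd k) \<in> borel_measurable M" "fst k \<in> I" using meas U by auto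
        show "Z (fst k) (snd k) \<in> borel_measurable M" by measurable
        show "(\<lambda>f. Z (fst k) (snd k) (f (fst k))) \<in> borel_measurable ?N" by measurable
        show "E (fst k) (snd k) \<in> sets borel" using SE k by auto
      next
        fix a :: "'i \<times> 't \<Rightarrow> real"
        have "(CLINT f|?N. iexp (\<Sum>k\<in>I \<times> U. a k * Z (fst k) (snd k) (f (fst k)))) = 
           (CLINT f|?N. (\<Prod>i\<in>I. iexp (\<Sum>t\<in>U. a (i, t) * Z i t (f i))))"
          using I U by (simp add: sum.cartesian_product' exp_sum sum_distrib_left split_def)
        also have "\<dots> = (\<Prod>i\<in>I. CLINT \<omega>|M. iexp (\<Sum>t\<in>U. a (i, t) * Z i t \<omega>))"
        proof (rule P.product_integral_prod[OF I(1)])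
          fix i assume i: "i \<in> I"
          have "(\<lambda>\<omega>. \<Sum>t\<in>U. a (i, t) * Z i t \<omega>) \<in> borel_measurable M"
            using meas[OF i] U by (intro borel_measurable_sum borel_measurable_times) auto
          then show "integrable M (\<lambda>\<omega>. iexp (\<Sum>t\<in>U. a (i, t) * Z i t \<omega>))"
            by (rule integrable_iexp)
        qed
        also have "\<dots> = (CLINT \<omega>|M. iexp (\<Sum>i\<in>I. \<Sum>t\<in>U. a (i, t) * Z i t \<omega>))"
          using char[OF U, of "\<lambda>i t. a (i, t)"] by simp
        also have "\<dots> = (CLINT \<omega>|M. iexp (\<Sum>k\<in>I \<times> U. a k * Z (fst k) (snd k) \<omega>))"
          by (simp add: sum.cartesian_product split_def)
        finally show "(CLINT \<omega>|M. iexp (\<Sum>k\<in>I \<times> U. a k * Z (fst k) (snd k) \<omega>)) =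
          (CLINT f|?N. iexp (\<Sum>k\<in>I \<times> U. a k * Z (fst k) (snd k) (f (fst k))))" by simp
      qed
      also have "{\<omega>\<in>space M. \<forall>k\<in>I \<times> U. Z (fst k) (snd k) \<omega> \<in> E (fst k) (snd k)} = (\<Inter>j\<in>I. A j)"
        using AU I(2) by auto
      also have "{f\<in>space ?N. \<forall>k\<in>I \<times> U. Z (fst k) (snd k) (f (fst k)) \<in> E (fst k) (snd k)} = (\<Pi>\<^sub>E j\<in>I. A j)"
        using AU by (auto simp: space_PiM PiE_iff extensional_def)
      also have "measure ?N (\<Pi>\<^sub>E j\<in>I. A j) = (\<Prod>j\<in>I. prob (A j))"
        using A Fev by (intro P.prob_times) (auto simp: Pi_iff)
      finally show "prob (\<Inter>j\<in>I. A j) = (\<Prod>j\<in>I. prob (A j))" .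
    qed
  qed auto
  then have "indep_sets (\<lambda>i. sigma_sets (space M) (F i)) I"
  proof (rule indep_sets_sigma)
    fix i
    show "Int_stable (F i)"
    proof (rule Int_stableI)
      fix a b assume "a \<in> F i" "b \<in> F i"
      then obtain B C where BC: "a = X i -` B \<inter> space M" "b = X i -` C \<inter> space M" "B \<in> G" "C \<in> G"
        unfolding F_def by auto
      then have "B \<inter> C \<in> G" using Int_stable_prod_algebra unfolding G_def by (auto simp: Int_stable_def)
      moreover have "a \<inter> b = X i -` (B \<inter> C) \<inter> space M" using BC by auto
      ultimately show "a \<inter> b \<in> F i" unfolding F_def by (intro CollectI exI[of _ "B \<inter> C"] conjI)
    qed
  qed
  moreover have "sigma_sets (space M) (F i) = {X i -` A \<inter> space M | A. A \<in> sets (Pi\<^sub>M T (\<lambda>_. borel))}" if "i \<in> I" for i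
  proof -
    have "X i \<in> space M \<rightarrow> \<Omega>'" using measurable_space[OF X[OF that]] by (auto simp: \<Omega>'_def)
    from sigma_sets_vimage_commute[OF this, of G] show ?thesis
      unfolding F_def sets_PiM G_def \<Omega>'_def space_PiM by simp
  qed
  ultimately have "indep_sets (\<lambda>i. {X i -` A \<inter> space M | A. A \<in> sets (Pi\<^sub>M T (\<lambda>_. borel))}) I"
    by (simp cong: indep_sets_cong)
  then show ?thesis
    unfolding indep_vars_def2 using X by (simp add: X_def[abs_def])
qed

text \<open>Variance 0 is treated separately, as there is no density; uniqueness then identifies the
  law with the point mass at 0. For v > 0 the rescaled variable X / sqrt v is standard
  normal.\<close>

lemma (in prob_space) gaussian_of_char:
  fixes X :: "'a \<Rightarrow> real"
  assumes [measurable]: "X \<in> borel_measurable M" and v: "0 \<le> v"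
    and char: "\<And>\<theta>. (CLINT \<omega>|M. iexp (\<theta> * X \<omega>)) = of_real (exp (- (\<theta>\<^sup>2 * v) / 2))"
  shows "gaussian M X" "expectation X = 0" "expectation (\<lambda>\<omega>. (X \<omega>)\<^sup>2) = v"
proof -
  have "gaussian M X \<and> expectation X = 0 \<and> expectation (\<lambda>\<omega>. (X \<omega>)\<^sup>2) = v"
  proof (cases "v = 0")
    case True
    have "distr M borel X = return borel 0"
    proof (rule Levy_uniqueness)
      show "real_distribution (distr M borel X)" by (rule real_distribution_distr) simp
      show "real_distribution (return borel 0)"
        by (simp add: real_distribution_def real_distribution_axioms_def prob_space_return)
      show "char (distr M borel X) = char (return borel 0)"
        using char True by (intro ext) (simp add: char_def integral_distr integral_return)
    qed
    moreover have "AE x in return borel 0. x = (0::real)"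
      by (subst AE_return) auto
    ultimately have "AE x in distr M borel X. x = 0" by (simp only:)
    then have ae: "AE \<omega> in M. X \<omega> = 0" by (subst (asm) AE_distr_iff) auto
    have "expectation X = 0" using ae by (rule integral_eq_zero_AE)
    moreover have "expectation (\<lambda>\<omega>. (X \<omega>)\<^sup>2) = 0"
      by (rule integral_eq_zero_AE) (use ae in eventually_elim, simp)
    moreover have "gaussian M X" unfolding gaussian_def using ae by auto
    ultimately show ?thesis using True by simp
  next
    case False
    define \<sigma> where "\<sigma> = sqrt v"
    have \<sigma>: "0 < \<sigma>" "\<sigma>\<^sup>2 = v" using False v by (auto simp: \<sigma>_def)
    have "distr M borel (\<lambda>\<omega>. X \<omega> / \<sigma>) = std_normal_distribution"
    proof (rule Levy_uniqueness)
      show "real_distribution (distr M borel (\<lambda>\<omega>. X \<omega> / \<sigma>))" by (rule real_distribution_distr) simp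
      show "real_distribution std_normal_distribution" by (rule real_dist_normal_dist)
      show "char (distr M borel (\<lambda>\<omega>. X \<omega> / \<sigma>)) = char std_normal_distribution"
      proof
        fix t
        have "char (distr M borel (\<lambda>\<omega>. X \<omega> / \<sigma>)) t = (CLINT \<omega>|M. iexp ((t / \<sigma>) * X \<omega>))"
          by (simp add: char_def integral_distr)
        also have "\<dots> = of_real (exp (- t\<^sup>2 / 2))"
          unfolding char using \<sigma>(1) by (simp add: power_divide flip: \<sigma>(2))
        finally show "char (distr M borel (\<lambda>\<omega>. X \<omega> / \<sigma>)) t = char std_normal_distribution t"
          by (simp add: char_std_normal_distribution)
      qed
    qed
    moreover have "distr M lborel (\<lambda>\<omega>. X \<omega> / \<sigma>) = distr M borel (\<lambda>\<omega>. X \<omega> / \<sigma>)"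
      by (rule distr_cong) auto
    ultimately have "distributed M lborel (\<lambda>\<omega>. (X \<omega> - 0) / \<sigma>) std_normal_density"
      by (simp add: distributed_def)
    then have D: "distributed M lborel X (normal_density 0 \<sigma>)"
      using normal_standard_normal_convert[OF \<sigma>(1)] by simp
    have "expectation X = 0" using normal_distributed_expectation[OF \<sigma>(1) D] .
    moreover from this have "expectation (\<lambda>\<omega>. (X \<omega>)\<^sup>2) = v"
      using normal_distributed_variance[OF \<sigma>(1) D] \<sigma>(2) by simp
    moreover have "gaussian M X" unfolding gaussian_def using D \<sigma>(1) by auto
    ultimately show ?thesis by simp
  qed
  then show "gaussian M X" "expectation X = 0" "expectation (\<lambda>\<omega>. (X \<omega>)\<^sup>2) = v" by auto
qed

section \<open>The process\<close>

text \<open>Orthonormality of the canonical basis: it turns the squared norm of a paired function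
  into a sum over components, with no mixed terms.\<close>

lemma norm_sum_axis_power2:
  fixes u :: "'d::finite \<Rightarrow> real"
  shows "(norm (\<Sum>i\<in>UNIV. u i *\<^sub>R axis i (1::real)))\<^sup>2 = (\<Sum>i\<in>UNIV. (u i)\<^sup>2)"
proof -
  have "(\<Sum>i\<in>UNIV. u i *\<^sub>R axis i (1::real)) = (\<chi> i. u i)"
    by (simp add: vec_eq_iff axis_def if_distrib[of "(*) _"] cong: if_cong)
  then show ?thesis by (simp add: norm_vec_def L2_set_def sum_nonneg)
qed

context
  fixes \<alpha> \<beta> :: real
    and \<mu> :: "('d::finite) functional measure"
    and B :: "real \<Rightarrow> 'd functional \<Rightarrow> real ^ 'd"
  assumes \<beta>: "0 < \<beta>" and \<alpha>: "0 < \<alpha>" "\<alpha> < 2"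
    and \<mu>: "mittag_leffler_measure \<beta> \<mu>"
    and pair: "\<And>t i. t \<ge> 0 \<Longrightarrow>
      dual_pairing \<mu> (\<lambda>x. M_minus \<alpha> (indicator {0..<t}) x *\<^sub>R axis i 1) (\<lambda>\<omega>. B t \<omega> $ i)"
begin

text \<open>For a finite set \<open>S\<close> of nonnegative times this is the quadratic form of the
  fractional covariance matrix; for \<beta> = 1 it is the variance of the combination of one
  component with coefficients \<open>b\<close>.\<close>

definition kernel_form :: "real set \<Rightarrow> (real \<Rightarrow> real) \<Rightarrow> real" where
  "kernel_form S b = (\<integral>x. (\<Sum>t\<in>S. b t * M_minus \<alpha> (indicator {0..<t}) x)\<^sup>2 \<partial>lborel)"

lemma kernel_form_integrable:
  assumes "S \<subseteq> {0..}"
  shows "integrable lborel (\<lambda>x. (\<Sum>t\<in>S. b t * M_minus \<alpha> (indicator {0..<t}) x)\<^sup>2)"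
proof -
  have eq: "(\<Sum>t\<in>S. b t * M_minus \<alpha> (indicator {0..<t}) x)\<^sup>2 = 
    (\<Sum>s\<in>S. \<Sum>t\<in>S. b s * b t * (M_minus \<alpha> (indicator {0..<s}) x * M_minus \<alpha> (indicator {0..<t}) x))" for x
    by (simp add: power2_eq_square sum_product mult_ac)
  show ?thesis unfolding eq
    using assms has_bochner_integral_M_minus_product[OF \<alpha>]
    by (intro Bochner_Integration.integrable_sum integrable_mult_right) (auto simp: has_bochner_integral_iff)
qed

lemma char_components:
  assumes S: "finite S" "S \<subseteq> {0..}"
  shows "(CLINT \<omega>|\<mu>. iexp (\<Sum>i\<in>UNIV. \<Sum>t\<in>S. a i t * B t \<omega> $ i)) =
     of_real (mittag_leffler_real \<beta> (- (\<Sum>i\<in>UNIV. kernel_form S (a i)) / 2))"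
proof -
  \<comment> \<open>The factor 1 gives the outer sum the shape of a linear combination, so that
    \<open>dual_pairing_sum\<close> applies at both levels.\<close>
  define \<eta> where "\<eta> x = (\<Sum>i\<in>UNIV. (1::real) *\<^sub>R (\<Sum>t\<in>S. a i t *\<^sub>R (M_minus \<alpha> (indicator {0..<t}) x *\<^sub>R axis i (1::real))))" for x
  have "dual_pairing \<mu> \<eta> (\<lambda>\<omega>. \<Sum>i\<in>UNIV. 1 * (\<Sum>t\<in>S. a i t * B t \<omega> $ i))"
    unfolding \<eta>_def[abs_def] using S pair
    by (intro dual_pairing_sum[OF \<mu>]) auto
  from dual_pairing_iexp[OF \<mu> \<beta> this]
  have "(CLINT \<omega>|\<mu>. iexp (\<Sum>i\<in>UNIV. \<Sum>t\<in>S. a i t * B t \<omega> $ i)) = 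
      of_real (mittag_leffler_real \<beta> (- (\<integral>x. (norm (\<eta> x))\<^sup>2 \<partial>lborel) / 2))"
    by simp
  also have "(\<integral>x. (norm (\<eta> x))\<^sup>2 \<partial>lborel) = (\<Sum>i\<in>UNIV. kernel_form S (a i))"
  proof -
    have "\<eta> x = (\<Sum>i\<in>UNIV. (\<Sum>t\<in>S. a i t * M_minus \<alpha> (indicator {0..<t}) x) *\<^sub>R axis i 1)" for x
      unfolding \<eta>_def by (simp add: scaleR_left.sum)
    then have "(norm (\<eta> x))\<^sup>2 = (\<Sum>i\<in>UNIV. (\<Sum>t\<in>S. a i t * M_minus \<alpha> (indicator {0..<t}) x)\<^sup>2)" for x
      by (simp only: norm_sum_axis_power2)
    then show ?thesis
      unfolding kernel_form_def using kernel_form_integrable[OF S(2)] by simp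
  qed
  finally show ?thesis .
qed

lemma char_component:
  assumes S: "finite S" "S \<subseteq> {0..}"
  shows "(CLINT \<omega>|\<mu>. iexp (\<Sum>t\<in>S. b t * B t \<omega> $ i)) =
     of_real (mittag_leffler_real \<beta> (- kernel_form S b / 2))"
proof -
  define a where "a j t = (if j = i then b t else 0)" for j t
  have "(\<Sum>t\<in>S. a j t * B t \<omega> $ j) = (if j = i then \<Sum>t\<in>S. b t * B t \<omega> $ i else 0)" for j \<omega>
    by (simp add: a_def)
  moreover have "kernel_form S (a j) = (if j = i then kernel_form S b else 0)" for j
    by (simp add: a_def kernel_form_def)
  ultimately show ?thesis using char_components[OF S, of a] by simp
qed

lemma kernel_form_scale: "kernel_form S (\<lambda>t. c * b t) = c\<^sup>2 * kernel_form S b"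
  by (simp add: kernel_form_def power_mult_distrib mult.assoc flip: sum_distrib_left)

lemma kernel_form_nonneg: "0 \<le> kernel_form S b"
  by (simp add: kernel_form_def)

lemma kernel_form_singleton: "0 \<le> t \<Longrightarrow> kernel_form {t} b = (b t)\<^sup>2 * t powr \<alpha>"
  using has_bochner_integral_integral_eq[OF has_bochner_integral_M_minus_product[OF \<alpha>, of t t]]
  by (simp add: kernel_form_def power_mult_distrib flip: power2_eq_square)

section \<open>From independence to \<beta> = 1\<close>

lemma indep_components_imp_one:
  assumes d: "CARD('d) \<ge> 2" and \<beta>1: "\<beta> \<le> 1" and ind: "indep_components \<mu> B"
  shows "\<beta> = 1"
proof (rule mittag_leffler_multiplicative_imp_one[OF \<beta> \<beta>1])
  interpret prob_space \<mu> using \<mu> by (simp add: mittag_leffler_measure_def)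
  fix x :: real assume x: "0 < x"
  \<comment> \<open>The kernel at time 1 has norm 1, so frequency \<open>r\<close> gives the
    argument -r^2/2 = -x for one component and -2x for the sum of two.\<close>
  define r where "r = sqrt (2 * x)"
  have r: "r\<^sup>2 = 2 * x" using x by (simp add: r_def)
  obtain i j :: 'd where ij: "i \<noteq> j"
    using d card_le_Suc0_iff_eq[of "UNIV :: 'd set"] by fastforce
  have single: "(CLINT \<omega>|\<mu>. iexp (r * B 1 \<omega> $ k)) = of_real (mittag_leffler_real \<beta> (- x))" for k
    using char_component[of "{1}" "\<lambda>_. r" k] by (simp add: kernel_form_singleton r)
  \<comment> \<open>Evaluation at time 1 is measurable on path space, so independence of paths
    passes to the values.\<close>
  have "indep_vars (\<lambda>_. borel) (\<lambda>i \<omega>. (\<lambda>f. iexp (r * f 1)) (\<lambda>t\<in>{0..}. B t \<omega> $ i)) UNIV"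
    by (rule indep_vars_compose2[OF ind[unfolded indep_components_def]]) measurable
  then have "indep_vars (\<lambda>_. borel) (\<lambda>i \<omega>. iexp (r * B 1 \<omega> $ i)) {i, j}"
    by (auto intro: indep_vars_subset)
  then have "(CLINT \<omega>|\<mu>. (\<Prod>k\<in>{i, j}. iexp (r * B 1 \<omega> $ k))) = (\<Prod>k\<in>{i, j}. CLINT \<omega>|\<mu>. iexp (r * B 1 \<omega> $ k))"
  proof (rule indep_vars_lebesgue_integral[rotated])
    fix k
    have [measurable]: "(\<lambda>\<omega>. B 1 \<omega> $ k) \<in> borel_measurable \<mu>"
      using pair[of 1 k] by (intro dual_pairing_borel_measurable) auto
    show "integrable \<mu> (\<lambda>\<omega>. iexp (r * B 1 \<omega> $ k))"
      by (intro integrable_const_bound[of _ 1]) auto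
  qed simp
  also have "\<dots> = of_real ((mittag_leffler_real \<beta> (- x))\<^sup>2)"
    unfolding single using ij by (simp add: power2_eq_square)
  also have "(CLINT \<omega>|\<mu>. (\<Prod>k\<in>{i, j}. iexp (r * B 1 \<omega> $ k))) = of_real (mittag_leffler_real \<beta> (- (2 * x)))"
  proof -
    define a where "a k t = (if k = i \<or> k = j then r else 0)" for k :: 'd and t :: real
    have sel: "(\<Sum>k\<in>UNIV. if k = i \<or> k = j then f k else 0) = f i + f j" for f :: "'d \<Rightarrow> real"
    proof -
      have "(\<Sum>k\<in>UNIV. if k = i \<or> k = j then f k else 0) = (\<Sum>k\<in>{i, j}. f k)"
        by (rule sum.mono_neutral_cong_right) auto
      then show ?thesis using ij by simp
    qed
    have "(\<Sum>k\<in>UNIV. \<Sum>t\<in>{1}. a k t * B t \<omega> $ k) = r * B 1 \<omega> $ i + r * B 1 \<omega> $ j" for \<omega>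
      using sel[of "\<lambda>k. r * B 1 \<omega> $ k"] by (simp add: a_def if_distrib[of "\<lambda>u. u * _"] cong: if_cong)
    moreover have "(\<Sum>k\<in>UNIV. kernel_form {1} (a k)) = 4 * x"
      using sel[of "\<lambda>_. r\<^sup>2"] r by (simp add: kernel_form_singleton a_def if_distrib[of "\<lambda>u. u\<^sup>2"] cong: if_cong)
    ultimately show ?thesis
      using char_components[of "{1}" a] ij by (simp add: iexp_add[symmetric] exp_add[symmetric] distrib_left)
  qed
  finally show "mittag_leffler_real \<beta> (- (2 * x)) = (mittag_leffler_real \<beta> (- x))\<^sup>2"
    by (simp only: of_real_eq_iff)
qed

section \<open>From \<beta> = 1 to fractional Brownian motion\<close>

lemma one_imp_fractional_brownian_motion:
  assumes \<beta>1: "\<beta> = 1"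
  shows "fractional_brownian_motion \<mu> \<alpha> B"
proof -
  interpret prob_space \<mu> using \<mu> by (simp add: mittag_leffler_measure_def)
  have ml: "mittag_leffler_real \<beta> u = exp u" for u by (simp add: \<beta>1 mittag_leffler_real_1)
  have L2: "(\<lambda>\<omega>. B t \<omega> $ i) \<in> L2_space \<mu>" if "0 \<le> t" for t i
    using pair[OF that] by (rule dual_pairing_L2_space)
  then have meas: "(\<lambda>\<omega>. B t \<omega> $ i) \<in> borel_measurable \<mu>" if "0 \<le> t" for t i
    using that by (simp add: L2_space_def)
  have gaussian: "gaussian \<mu> (\<lambda>\<omega>. \<Sum>t\<in>J. c t \<bullet> B t \<omega>)" if J: "finite J" "J \<subseteq> {0..}" for J and c :: "real \<Rightarrow> real ^ 'd"
  proof (rule gaussian_of_char(1))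
    have eq: "(\<Sum>t\<in>J. c t \<bullet> B t \<omega>) = (\<Sum>i\<in>UNIV. \<Sum>t\<in>J. c t $ i * B t \<omega> $ i)" for \<omega>
      unfolding inner_vec_def by (subst sum.swap) simp
    show "(\<lambda>\<omega>. \<Sum>t\<in>J. c t \<bullet> B t \<omega>) \<in> borel_measurable \<mu>"
      unfolding eq using J meas by (intro borel_measurable_sum borel_measurable_times) auto
    show "0 \<le> (\<Sum>i\<in>UNIV. kernel_form J (\<lambda>t. c t $ i))" by (intro sum_nonneg kernel_form_nonneg)
    show "(CLINT \<omega>|\<mu>. iexp (\<theta> * (\<Sum>t\<in>J. c t \<bullet> B t \<omega>))) = 
      of_real (exp (- (\<theta>\<^sup>2 * (\<Sum>i\<in>UNIV. kernel_form J (\<lambda>t. c t $ i))) / 2))" for \<theta>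
      using char_components[OF J, of "\<lambda>i t. \<theta> * c t $ i"]
      unfolding eq kernel_form_scale ml by (simp add: sum_distrib_left mult.assoc)
  qed
  have comp: "expectation (\<lambda>\<omega>. \<Sum>t\<in>J. b t * B t \<omega> $ i) = 0" 
    "expectation (\<lambda>\<omega>. (\<Sum>t\<in>J. b t * B t \<omega> $ i)\<^sup>2) = kernel_form J b"
    if J: "finite J" "J \<subseteq> {0..}" for J b i
  proof -
    have m: "(\<lambda>\<omega>. \<Sum>t\<in>J. b t * B t \<omega> $ i) \<in> borel_measurable \<mu>"
      using J meas by (intro borel_measurable_sum borel_measurable_times) auto
    have ch: "(CLINT \<omega>|\<mu>. iexp (\<theta> * (\<Sum>t\<in>J. b t * B t \<omega> $ i))) = 
      of_real (exp (- (\<theta>\<^sup>2 * kernel_form J b) / 2))" for \<theta>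
      using char_component[OF J, of "\<lambda>t. \<theta> * b t" i]
      unfolding kernel_form_scale ml by (simp add: sum_distrib_left mult.assoc)
    show "expectation (\<lambda>\<omega>. \<Sum>t\<in>J. b t * B t \<omega> $ i) = 0" 
      "expectation (\<lambda>\<omega>. (\<Sum>t\<in>J. b t * B t \<omega> $ i)\<^sup>2) = kernel_form J b"
      by (rule gaussian_of_char[OF m kernel_form_nonneg ch])+
  qed
  have mean: "(\<integral>\<omega>. B t \<omega> $ i \<partial>\<mu>) = 0" if "0 \<le> t" for t i
    using comp(1)[of "{t}" "\<lambda>_. 1" i] that by simp
  have sq: "(\<integral>\<omega>. (B t \<omega> $ i)\<^sup>2 \<partial>\<mu>) = t powr \<alpha>" if "0 \<le> t" for t i
    using comp(2)[of "{t}" "\<lambda>_. 1" i] that by (simp add: kernel_form_singleton)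
  have cov: "(\<integral>\<omega>. B t \<omega> $ i * B s \<omega> $ i \<partial>\<mu>) = (t powr \<alpha> + s powr \<alpha> - \<bar>t - s\<bar> powr \<alpha>) / 2"
    if t: "0 \<le> t" and s: "0 \<le> s" for t s i
  proof (cases "s = t")
    case True
    then show ?thesis using sq[OF t] by (simp add: power2_eq_square)
  next
    case False
    \<comment> \<open>The coefficients of the increment between the two times. The case s = t is set
      apart because the set \<open>{t, s}\<close> then collapses to a single point.\<close>
    define b where "b u = (if u = t then 1 else -1 :: real)" for u
    have sums: "(\<Sum>u\<in>{t, s}. b u * f u) = f t - f s" for f :: "real \<Rightarrow> real"
      using False by (simp add: b_def)
    have i: "integrable \<mu> (\<lambda>\<omega>. (B t \<omega> $ i)\<^sup>2)" "integrable \<mu> (\<lambda>\<omega>. (B s \<omega> $ i)\<^sup>2)"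
      "integrable \<mu> (\<lambda>\<omega>. (B t \<omega> $ i - B s \<omega> $ i)\<^sup>2)"
      using L2[OF t, of i] L2[OF s, of i] L2_space_diff[OF L2[OF t, of i] L2[OF s, of i]] by (auto simp: L2_space_def)
    have "(\<integral>\<omega>. (B t \<omega> $ i - B s \<omega> $ i)\<^sup>2 \<partial>\<mu>) = kernel_form {t, s} b"
      using comp(2)[of "{t, s}" b i] t s by (simp only: sums) simp
    also have "\<dots> = \<bar>t - s\<bar> powr \<alpha>"
      unfolding kernel_form_def sums
      by (rule has_bochner_integral_integral_eq[OF has_bochner_integral_M_minus_increment[OF \<alpha> t s]])
    finally have diff: "(\<integral>\<omega>. (B t \<omega> $ i - B s \<omega> $ i)\<^sup>2 \<partial>\<mu>) = \<bar>t - s\<bar> powr \<alpha>" .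
    have "(\<integral>\<omega>. B t \<omega> $ i * B s \<omega> $ i \<partial>\<mu>) = 
        (\<integral>\<omega>. ((B t \<omega> $ i)\<^sup>2 + (B s \<omega> $ i)\<^sup>2 - (B t \<omega> $ i - B s \<omega> $ i)\<^sup>2) / 2 \<partial>\<mu>)"
      by (simp add: power2_diff)
    also have "\<dots> = (t powr \<alpha> + s powr \<alpha> - \<bar>t - s\<bar> powr \<alpha>) / 2"
      using i sq[OF t, of i] sq[OF s, of i] diff by simp
    finally show ?thesis .
  qed
  have "indep_vars (\<lambda>_. Pi\<^sub>M {0..} (\<lambda>_. borel)) (\<lambda>i \<omega>. \<lambda>t\<in>{0..}. B t \<omega> $ i) UNIV"
  proof (rule indep_vars_paths_of_char)
    fix S :: "real set" and a :: "'d \<Rightarrow> real \<Rightarrow> real" assume S: "finite S" "S \<subseteq> {0..}"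
    show "(CLINT \<omega>|\<mu>. iexp (\<Sum>i\<in>UNIV. \<Sum>t\<in>S. a i t * B t \<omega> $ i)) = (\<Prod>i\<in>UNIV. CLINT \<omega>|\<mu>. iexp (\<Sum>t\<in>S. a i t * B t \<omega> $ i))"
      \<comment> \<open>The exponent is additive over the components, and the exponential turns this
        sum into the required product.\<close>
      unfolding char_components[OF S] char_component[OF S] ml
      by (simp add: sum_negf flip: of_real_prod exp_sum sum_divide_distrib)
  qed (use meas in auto)
  then have "indep_components \<mu> B" by (simp add: indep_components_def)
  then show ?thesis
    unfolding fractional_brownian_motion_def gaussian_process_def
    using gaussian mean cov by auto
qed

end

theorem mainTheorem2:
  fixes \<alpha> \<beta> :: real
    and \<mu> :: "('d::finite) functional measure"
    and B :: "real \<Rightarrow> 'd functional \<Rightarrow> real ^ 'd"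
  assumes "CARD('d) \<ge> 2"
    and "0 < \<beta>" and "\<beta> \<le> 1"
    and "0 < \<alpha>" and "\<alpha> < 2"
    and "mittag_leffler_measure \<beta> \<mu>"
    and "\<And>t i. t \<ge> 0 \<Longrightarrow>
      dual_pairing \<mu> (\<lambda>x. M_minus \<alpha> (indicator {0..<t}) x *\<^sub>R axis i 1) (\<lambda>\<omega>. B t \<omega> $ i)"
  shows "(indep_components \<mu> B \<longleftrightarrow> fractional_brownian_motion \<mu> \<alpha> B) \<and>
         (fractional_brownian_motion \<mu> \<alpha> B \<longleftrightarrow> \<beta> = 1)"
proof -
  \<comment> \<open>Independence is one clause of the definition, which closes the cycle of three
    implications.\<close>
  have "fractional_brownian_motion \<mu> \<alpha> B \<Longrightarrow> indep_components \<mu> B"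
    by (simp add: fractional_brownian_motion_def)
  moreover have "indep_components \<mu> B \<Longrightarrow> \<beta> = 1"
    using indep_components_imp_one[OF assms(2,4,5,6,7,1,3)] .
  moreover have "\<beta> = 1 \<Longrightarrow> fractional_brownian_motion \<mu> \<alpha> B"
    using one_imp_fractional_brownian_motion[OF assms(2,4,5,6,7)] .
  ultimately show ?thesis by blast
qed

end
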